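(* The following statements are equivalent: (i) For every $t\in\mathbb{T}$ and every $x\in l^2_{\mathcal{F}}(t;\mathbb{R})$, Problem (MV)$_{tx}$ admits an open-loop equilibrium control. (ii) $\mathbb{E}O_k\in \mathrm{Ran}(\mathrm{Cov}(O_k))$ for all $k\in\mathbb{T}$. Moreover, under either of these conditions, for every $t\in\mathbb{T}$ and $x\in l^2_{\mathcal{F}}(t;\mathbb{R})$, $$v^{t,x}_k=-\widehat{\mathcal{O}}_k^\dagger\widehat{\mathcal{L}}_k\widehat{X}^{t,x,*}_k-\widehat{\mathcal{O}}_k^\dagger\widehat{\theta}_k,\qquad k\in\mathbb{T}_t,$$ is an open-loop equilibrium control of Problem (MV)$_{tx}$, where $$\widehat{X}^{t,x,*}_{k+1}=\big(s_k-O_k^T\widehat{\mathcal{O}}_k^\dagger\widehat{\mathcal{L}}_k\big)\widehat{X}^{t,x,*}_k-O_k^T\widehat{\mathcal{O}}_k^\dagger\widehat{\theta}_k,\quad k\in\mathbb{T}_t,\qquad \widehat{X}^{t,x,*}_t=x,$$ and, for $k\in\mathbb{T}_t$, $$\widehat{\mathcal{O}}_k=\big(\widehat{S}_{k+1}+\widehat{T}_{k+1}\big)\mathrm{Cov}(O_k),\quad \widehat{\mathcal{L}}_k=-\tfrac{\mu_1}{2}s_{k+1}\cdots s_{N-1}\,\mathbb{E}O_k,\quad \widehat{\theta}_k=-\tfrac{\mu_2}{2}s_{k+1}\cdots s_{N-1}\,\mathbb{E}O_k,$$ with the scalars $\widehat{S}_k+\widehat{T}_k$ determined by the backward recursion $$\widehat{S}_k+\widehat{T}_k=\big(\widehat{S}_{k+1}+\widehat{T}_{k+1}\big)s_k^2-s_k\big(\widehat{S}_{k+1}+\widehat{T}_{k+1}\big)(\mathbb{E}O_k)^T\widehat{\mathcal{O}}_k^\dagger\widehat{\mathcal{L}}_k,\quad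 k\in\mathbb{T}_t,\qquad \widehat{S}_N+\widehat{T}_N=1.$$
   Context: Model. $N\ge 1$ and $m\ge 1$ are integers, $\mathbb{T}=\{0,\dots,N-1\}$, $\mathbb{T}_t=\{t,\dots,N-1\}$. For $k\in\mathbb{T}$, $s_k>1$ is a given deterministic number (return of the riskless asset) and $e_k=(e_k^1,\dots,e_k^m)^T$ is an $\mathbb{R}^m$-valued random vector with finite second moments (returns of $m$ risky assets); $e_0,\dots,e_{N-1}$ are independent. $O_k=(e_k^1-s_k,\dots,e_k^m-s_k)^T$ is the excess return vector, and $\mathrm{Cov}(O_k)=\mathrm{Cov}(e_k)=\mathbb{E}[(e_k-\mathbb{E}e_k)(e_k-\mathbb{E}e_k)^T]\succeq0$ (not assumed nonsingular). $\mathcal{F}_k=\sigma(e_\ell,\ \ell=0,\dots,k-1)$ ($\mathcal{F}_0$ trivial) and $\mathbb{E}_t=\mathbb{E}[\,\cdot\,|\mathcal{F}_t]$. $l^2_{\mathcal{F}}(k;\mathbb{R}^d)$ is the set of $\mathcal{F}_k$-measurable square-integrable $\mathbb{R}^d$-valued random variables, and $l^2_{\mathcal{F}}(\mathbb{T}_t;\mathbb{R}^m)$ is the set of processes $\{\nu_k,k\in\mathbb{T}_t\}$ with $\nu_k\in l^2_{\mathcal{F}}(k;\mathbb{R}^m)$ for each $k\in\mathbb{T}_t$. Problem (MV)$_{tx}$ (multi-period mean-variance problem for the initial pair $(t,x)$, $t\in\mathbb{T}$, $x\in l^2_{\mathcal{F}}(t;\mathbb{R})$): with controls $u\in l^2_{\mathcal{F}}(\mathbb{T}_t;\mathbb{R}^m)$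 (short-selling allowed), wealth dynamics $X_{k+1}=s_kX_k+O_k^Tu_k$, $k\in\mathbb{T}_t$, $X_t=x$, and cost $$J(t,x;u)=\mathbb{E}_t(X_N-\mathbb{E}_tX_N)^2-(\mu_1x+\mu_2)\mathbb{E}_tX_N,$$ where $\mu_1,\mu_2>0$ are constants. Open-loop equilibrium control. $u^{t,x}\in l^2_{\mathcal{F}}(\mathbb{T}_t;\mathbb{R}^m)$ is an open-loop equilibrium control of Problem (MV)$_{tx}$ if $$J\big(k,X_k^{t,x,*};u^{t,x}|_{\mathbb{T}_k}\big)\le J\big(k,X_k^{t,x,*};(u_k,u^{t,x}|_{\mathbb{T}_{k+1}})\big)$$ for every $k\in\mathbb{T}_t$ and every $u_k\in l^2_{\mathcal{F}}(k;\mathbb{R}^m)$, where $u^{t,x}|_{\mathbb{T}_k}$, $u^{t,x}|_{\mathbb{T}_{k+1}}$ are the restrictions of the process $u^{t,x}$ to $\mathbb{T}_k=\{k,\dots,N-1\}$ and $\mathbb{T}_{k+1}=\{k+1,\dots,N-1\}$ and $X^{t,x,*}_{k+1}=s_kX^{t,x,*}_k+O_k^Tu^{t,x}_k$, $X^{t,x,*}_t=x$. Inequalities between random variables hold almost surely. Notation: $A^\dagger$ is the Moore–Penrose inverse, $\mathrm{Ran}(A)$ the range (column space) of a matrix $A$; $s_{k+1}\cdots s_{N-1}=1$ when $k=N-1$. *)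

theory Defs
  imports "HOL-Probability.Probability"
begin

definition mp_inverse :: "real^'n^'m \<Rightarrow> real^'m^'n" where
  "mp_inverse A = (THE B. A ** B ** A = A \<and> B ** A ** B = B \<and>
     transpose (A ** B) = A ** B \<and> transpose (B ** A) = B ** A)"

definition mat_range :: "real^'n^'m \<Rightarrow> (real^'m) set" where
  "mat_range A = range (\<lambda>y. A *v y)"

definition cov_matrix :: "'a measure \<Rightarrow> ('a \<Rightarrow> real^'m) \<Rightarrow> real^'m^'m" where
  "cov_matrix M Y = (\<chi> i j. \<integral>\<omega>. (Y \<omega> - integral\<^sup>L M Y) $ i * (Y \<omega> - integral\<^sup>L M Y) $ j \<partial>M)"


text \<open>The parameters are: the probability space \<open>M\<close>, the horizon \<open>N\<close>, the riskless returns \<open>s\<close>,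
  the risky returns \<open>e\<close> and the risk aversion constants \<open>\<mu>1\<close>, \<open>\<mu>2\<close>. The number of risky assets is
  \<open>CARD('m)\<close>. Only the values of \<open>s\<close>, \<open>e\<close> and of control processes at times below \<open>N\<close> matter.\<close>

definition excess :: "(nat \<Rightarrow> real) \<Rightarrow> (nat \<Rightarrow> 'a \<Rightarrow> real^'m) \<Rightarrow> nat \<Rightarrow> 'a \<Rightarrow> real^'m" where
  "excess s e k \<omega> = (\<chi> i. e k \<omega> $ i - s k)"

definition filt :: "'a measure \<Rightarrow> (nat \<Rightarrow> 'a \<Rightarrow> real^'m) \<Rightarrow> nat \<Rightarrow> 'a measure" where
  "filt M e k = sigma (space M) {e l -` A \<inter> space M | l A. l < k \<and> A \<in> sets borel}"

definition L2F :: "'a measure \<Rightarrow> (nat \<Rightarrow> 'a \<Rightarrow> real^'m) \<Rightarrow> nat \<Rightarrow> ('a \<Rightarrow> 'b::euclidean_space) set" where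
  "L2F M e k = {Y \<in> borel_measurable (filt M e k). integrable M (\<lambda>\<omega>. (norm (Y \<omega>))\<^sup>2)}"

definition controls ::
  "'a measure \<Rightarrow> nat \<Rightarrow> (nat \<Rightarrow> 'a \<Rightarrow> real^'m) \<Rightarrow> nat \<Rightarrow> (nat \<Rightarrow> 'a \<Rightarrow> real^'m) set" where
  "controls M N e t = {u. \<forall>k\<in>{t..<N}. u k \<in> L2F M e k}"

text \<open>Wealth started from \<open>x\<close> at time \<open>t\<close>. The dynamics run over times \<open>k \<ge> t\<close>; the values at
  times before \<open>t\<close> are a dummy (\<open>x\<close>) and never used.\<close>

primrec wealth :: "(nat \<Rightarrow> real) \<Rightarrow> (nat \<Rightarrow> 'a \<Rightarrow> real^'m) \<Rightarrow> nat \<Rightarrow> ('a \<Rightarrow> real) \<Rightarrow>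
    (nat \<Rightarrow> 'a \<Rightarrow> real^'m) \<Rightarrow> nat \<Rightarrow> 'a \<Rightarrow> real" where
  "wealth s e t x u 0 = x"
| "wealth s e t x u (Suc k) =
     (if Suc k \<le> t then x else (\<lambda>\<omega>. s k * wealth s e t x u k \<omega> + excess s e k \<omega> \<bullet> u k \<omega>))"

definition mv_cost :: "'a measure \<Rightarrow> nat \<Rightarrow> (nat \<Rightarrow> real) \<Rightarrow> (nat \<Rightarrow> 'a \<Rightarrow> real^'m) \<Rightarrow> real \<Rightarrow> real \<Rightarrow>
    nat \<Rightarrow> ('a \<Rightarrow> real) \<Rightarrow> (nat \<Rightarrow> 'a \<Rightarrow> real^'m) \<Rightarrow> 'a \<Rightarrow> real" where
  "mv_cost M N s e \<mu>1 \<mu>2 t x u =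
     (let E = real_cond_exp M (filt M e t); X = wealth s e t x u N
      in (\<lambda>\<omega>. E (\<lambda>\<omega>'. (X \<omega>' - E X \<omega>')\<^sup>2) \<omega> - (\<mu>1 * x \<omega> + \<mu>2) * E X \<omega>))"

text \<open>The cost at time \<open>k\<close> depends only on the control at times in \<open>{k..<N}\<close>, so restrictions of
  control processes need not be formed explicitly; \<open>u(k := w)\<close> uses \<open>w\<close> at time \<open>k\<close> and \<open>u\<close>
  afterwards.\<close>

definition open_loop_equilibrium ::
  "'a measure \<Rightarrow> nat \<Rightarrow> (nat \<Rightarrow> real) \<Rightarrow> (nat \<Rightarrow> 'a \<Rightarrow> real^'m) \<Rightarrow> real \<Rightarrow> real \<Rightarrow>
    nat \<Rightarrow> ('a \<Rightarrow> real) \<Rightarrow> (nat \<Rightarrow> 'a \<Rightarrow> real^'m) \<Rightarrow> bool" where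
  "open_loop_equilibrium M N s e \<mu>1 \<mu>2 t x u \<longleftrightarrow>
     u \<in> controls M N e t \<and>
     (\<forall>k\<in>{t..<N}. \<forall>w\<in>L2F M e k. AE \<omega> in M.
        mv_cost M N s e \<mu>1 \<mu>2 k (wealth s e t x u k) u \<omega>
          \<le> mv_cost M N s e \<mu>1 \<mu>2 k (wealth s e t x u k) (u(k := w)) \<omega>)"


definition hatL :: "'a measure \<Rightarrow> nat \<Rightarrow> (nat \<Rightarrow> real) \<Rightarrow> (nat \<Rightarrow> 'a \<Rightarrow> real^'m) \<Rightarrow> real \<Rightarrow> nat \<Rightarrow> real^'m"
  where "hatL M N s e \<mu>1 k = (- (\<mu>1 / 2) * (\<Prod>l\<in>{Suc k..<N}. s l)) *\<^sub>R integral\<^sup>L M (excess s e k)"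

definition hat\<theta> :: "'a measure \<Rightarrow> nat \<Rightarrow> (nat \<Rightarrow> real) \<Rightarrow> (nat \<Rightarrow> 'a \<Rightarrow> real^'m) \<Rightarrow> real \<Rightarrow> nat \<Rightarrow> real^'m"
  where "hat\<theta> M N s e \<mu>2 k = (- (\<mu>2 / 2) * (\<Prod>l\<in>{Suc k..<N}. s l)) *\<^sub>R integral\<^sup>L M (excess s e k)"

text \<open>The scalar \<open>S\<^sub>k + T\<^sub>k\<close>, by backward recursion from its terminal value 1 at time \<open>N\<close>.\<close>

function hatST :: "'a measure \<Rightarrow> nat \<Rightarrow> (nat \<Rightarrow> real) \<Rightarrow> (nat \<Rightarrow> 'a \<Rightarrow> real^'m) \<Rightarrow> real \<Rightarrow> nat \<Rightarrow> real"
  where "hatST M N s e \<mu>1 k =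
    (if k < N then
       hatST M N s e \<mu>1 (Suc k) * (s k)\<^sup>2
       - s k * hatST M N s e \<mu>1 (Suc k) *
           (integral\<^sup>L M (excess s e k) \<bullet>
             (mp_inverse (hatST M N s e \<mu>1 (Suc k) *\<^sub>R cov_matrix M (excess s e k))
               *v hatL M N s e \<mu>1 k))
     else 1)"
  by pat_completeness auto
termination
  by (relation "Wellfounded.measure (\<lambda>(M, N, s, e, \<mu>1, k). N - k)") auto

declare hatST.simps [simp del]

definition hatO :: "'a measure \<Rightarrow> nat \<Rightarrow> (nat \<Rightarrow> real) \<Rightarrow> (nat \<Rightarrow> 'a \<Rightarrow> real^'m) \<Rightarrow> real \<Rightarrow> nat \<Rightarrow> real^'m^'m"
  where "hatO M N s e \<mu>1 k = hatST M N s e \<mu>1 (Suc k) *\<^sub>R cov_matrix M (excess s e k)"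

lemma hatST_terminal: "hatST M N s e \<mu>1 N = 1"
  by (simp add: hatST.simps)

lemma hatST_rec:
  "k < N \<Longrightarrow> hatST M N s e \<mu>1 k =
     hatST M N s e \<mu>1 (Suc k) * (s k)\<^sup>2
     - s k * hatST M N s e \<mu>1 (Suc k) *
         (integral\<^sup>L M (excess s e k) \<bullet> (mp_inverse (hatO M N s e \<mu>1 k) *v hatL M N s e \<mu>1 k))"
  by (subst hatST.simps) (simp add: hatO_def)

text \<open>As for \<open>wealth\<close>, the values at times before \<open>t\<close> are dummies.\<close>

primrec hatX :: "'a measure \<Rightarrow> nat \<Rightarrow> (nat \<Rightarrow> real) \<Rightarrow> (nat \<Rightarrow> 'a \<Rightarrow> real^'m) \<Rightarrow> real \<Rightarrow> real \<Rightarrow>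
    nat \<Rightarrow> ('a \<Rightarrow> real) \<Rightarrow> nat \<Rightarrow> 'a \<Rightarrow> real" where
  "hatX M N s e \<mu>1 \<mu>2 t x 0 = x"
| "hatX M N s e \<mu>1 \<mu>2 t x (Suc k) =
     (if Suc k \<le> t then x else
       (\<lambda>\<omega>. (s k - excess s e k \<omega> \<bullet> (mp_inverse (hatO M N s e \<mu>1 k) *v hatL M N s e \<mu>1 k))
               * hatX M N s e \<mu>1 \<mu>2 t x k \<omega>
             - excess s e k \<omega> \<bullet> (mp_inverse (hatO M N s e \<mu>1 k) *v hat\<theta> M N s e \<mu>2 k)))"

definition hatv :: "'a measure \<Rightarrow> nat \<Rightarrow> (nat \<Rightarrow> real) \<Rightarrow> (nat \<Rightarrow> 'a \<Rightarrow> real^'m) \<Rightarrow> real \<Rightarrow> real \<Rightarrow>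
    nat \<Rightarrow> ('a \<Rightarrow> real) \<Rightarrow> nat \<Rightarrow> 'a \<Rightarrow> real^'m" where
  "hatv M N s e \<mu>1 \<mu>2 t x k \<omega> =
     - (hatX M N s e \<mu>1 \<mu>2 t x k \<omega> *\<^sub>R (mp_inverse (hatO M N s e \<mu>1 k) *v hatL M N s e \<mu>1 k))
     - mp_inverse (hatO M N s e \<mu>1 k) *v hat\<theta> M N s e \<mu>2 k"

end

theory Submission
  imports Defs
begin

section \<open>Open-loop equilibria of the multi-period mean-variance problem\<close>

text \<open>
Changing the control at time \<open>k\<close> by \<open>d\<close> shifts the terminal wealth by
\<open>s (k+1) \<cdots> s (N-1)\<close> times the inner product of the excess return with \<open>d\<close>, and the excess return is
independent of the past. Hence, as soon as the conditional expectation of the terminal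
wealth at time \<open>k+1\<close> is an affine function \<open>\<alpha> X\<^sub>k\<^sub>+\<^sub>1 + \<beta>\<close> of the current wealth, the cost variation at
time \<open>k\<close> is a quadratic function of \<open>d\<close> with the positive semidefinite Hessian proportional to \<open>Cov(O\<^sub>k)\<close>, and
optimality amounts to the first-order condition \<open>2 \<alpha> Cov(O\<^sub>k) u\<^sub>k = (\<mu>1 X\<^sub>k + \<mu>2) E O\<^sub>k\<close>.

If \<open>E O\<^sub>k = Cov(O\<^sub>k) y\<close>, this condition determines the product of \<open>E O\<^sub>k\<close> and \<open>u\<^sub>k\<close> (although not \<open>u\<^sub>k\<close>)
as an affine function of \<open>X\<^sub>k\<close>, so that the affine form propagates backwards to time \<open>k\<close>, with
slope \<open>\<alpha> s\<^sub>k + \<mu>1/2 (y \<bullet> E O\<^sub>k) > 0\<close>. Starting from wealth 0 at time \<open>k\<close>, the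
first-order condition shows that \<open>E O\<^sub>k\<close> is in the range of \<open>Cov(O\<^sub>k)\<close>. Conversely, the slope is
\<open>S\<^sub>k + T\<^sub>k\<close> divided by \<open>s k \<cdots> s (N-1)\<close>, and the proposed control satisfies the first-order condition.
\<close>

subsection \<open>The Moore--Penrose inverse\<close>

lemma inner_matrix_vector_right:
  fixes A :: "real^'n^'m"
  shows "x \<bullet> (A *v y) = (transpose A *v x) \<bullet> y"
  by (simp add: dot_lmul_matrix)

text \<open>Pairing the hypothesis with \<open>v\<close> gives the squared norm of
  \<open>A *v v\<close>.\<close>

lemma gram_kernel:
  fixes A :: "real^'n^'m"
  assumes "transpose A *v (A *v v) = 0"
  shows "A *v v = 0"
  using inner_matrix_vector_right[of "A *v v" A v] assms by simp

lemma subspace_range_matrix: "subspace (range ((*v) (A :: real^'n^'m)))"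
  by (simp add: linear_subspace_image)

text \<open>The range of the transpose is orthogonal to the kernel of \<open>A\<close>, and
  \<open>x - y\<close> lies in both.\<close>

lemma range_transpose_eqI:
  fixes A :: "real^'n^'m"
  assumes "x - y \<in> range ((*v) (transpose A))" and "A *v x = A *v y"
  shows "x = y"
proof -
  obtain w where w: "x - y = transpose A *v w"
    using assms(1) by auto
  have "(x - y) \<bullet> (x - y) = w \<bullet> (A *v (x - y))"
    by (subst inner_matrix_vector_right) (simp add: w)
  also have "\<dots> = 0"
    using assms(2) by (simp add: matrix_vector_mult_diff_distrib)
  finally show ?thesis
    by simp
qed

text \<open>The minimum-norm least-squares solution of \<open>A x = y\<close>, characterised by the normal equations.\<close>

definition lsq_solution :: "real^'n^'m \<Rightarrow> real^'m \<Rightarrow> real^'n" where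
  "lsq_solution A y =
     (SOME x. x \<in> range ((*v) (transpose A)) \<and> transpose A *v (A *v x) = transpose A *v y)"

lemma lsq_solution:
  fixes A :: "real^'n^'m"
  shows "lsq_solution A y \<in> range ((*v) (transpose A))"
    and "transpose A *v (A *v lsq_solution A y) = transpose A *v y"
proof -
  have sp: "span (range ((*v) B)) = range ((*v) B)" for B :: "real^'p^'q"
    by (simp add: span_eq_iff subspace_range_matrix)
  \<comment> \<open>First \<open>y\<close> is projected onto the range of \<open>A\<close>, then a
    preimage \<open>z\<close> of the projection is projected onto the range of the transpose. The
    two remainders \<open>q\<close> and \<open>b\<close> are annihilated by the transpose and by
    \<open>A\<close> respectively, so \<open>a\<close> solves the normal equations.\<close>
  obtain p q where p: "p \<in> range ((*v) A)" and y: "y = p + q"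
    and q: "\<And>w. w \<in> range ((*v) A) \<Longrightarrow> orthogonal q w"
    using orthogonal_subspace_decomp_exists[of "range ((*v) A)" y] unfolding sp by blast
  obtain z where z: "p = A *v z"
    using p by auto
  obtain a b where a: "a \<in> range ((*v) (transpose A))" and zab: "z = a + b"
    and b: "\<And>w. w \<in> range ((*v) (transpose A)) \<Longrightarrow> orthogonal b w"
    using orthogonal_subspace_decomp_exists[of "range ((*v) (transpose A))" z] unfolding sp by blast
  have "(A *v b) \<bullet> (A *v b) = b \<bullet> (transpose A *v (A *v b))"
    by (simp add: inner_matrix_vector_right inner_commute)
  then have Ab: "A *v b = 0"
    using b by (simp add: orthogonal_def)
  have "(transpose A *v q) \<bullet> (transpose A *v q) = q \<bullet> (A *v (transpose A *v q))"
    by (simp add: inner_matrix_vector_right)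
  then have Aq: "transpose A *v q = 0"
    using q by (simp add: orthogonal_def)
  have "transpose A *v (A *v a) = transpose A *v y"
    using Ab Aq by (simp add: y z zab matrix_vector_right_distrib)
  with a have "\<exists>x. x \<in> range ((*v) (transpose A)) \<and> transpose A *v (A *v x) = transpose A *v y"
    by blast
  from someI_ex[OF this] show "lsq_solution A y \<in> range ((*v) (transpose A))"
    and "transpose A *v (A *v lsq_solution A y) = transpose A *v y"
    unfolding lsq_solution_def by blast+
qed

text \<open>The normal equations determine \<open>A *v x\<close> by \<open>gram_kernel\<close>;
  membership in the range of the transpose then determines \<open>x\<close>. Linearity of
  \<open>lsq_solution\<close> and one Penrose identity follow by exhibiting a candidate.\<close>

lemma lsq_solution_unique:
  fixes A :: "real^'n^'m"
  assumes "x \<in> range ((*v) (transpose A))" and "transpose A *v (A *v x) = transpose A *v y"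
  shows "lsq_solution A y = x"
proof (rule range_transpose_eqI)
  show "lsq_solution A y - x \<in> range ((*v) (transpose A))"
    by (rule subspace_diff[OF subspace_range_matrix lsq_solution(1) assms(1)])
  have "transpose A *v (A *v (lsq_solution A y - x)) = 0"
    using lsq_solution(2)[of A y] assms(2) by (simp add: matrix_vector_mult_diff_distrib)
  from gram_kernel[OF this] show "A *v lsq_solution A y = A *v x"
    by (simp add: matrix_vector_mult_diff_distrib)
qed

lemma linear_lsq_solution: "linear (lsq_solution A)"
proof (rule linearI)
  fix x y
  show "lsq_solution A (x + y) = lsq_solution A x + lsq_solution A y"
  proof (rule lsq_solution_unique)
    show "lsq_solution A x + lsq_solution A y \<in> range ((*v) (transpose A))"
      by (rule subspace_add[OF subspace_range_matrix lsq_solution(1) lsq_solution(1)])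
  qed (simp only: matrix_vector_right_distrib lsq_solution(2))
next
  fix c :: real and x
  show "lsq_solution A (c *\<^sub>R x) = c *\<^sub>R lsq_solution A x"
  proof (rule lsq_solution_unique)
    show "c *\<^sub>R lsq_solution A x \<in> range ((*v) (transpose A))"
      by (rule subspace_scale[OF subspace_range_matrix lsq_solution(1)])
  qed (simp only: matrix_vector_mult_scaleR lsq_solution(2))
qed

lemma transpose_eq_selfI:
  fixes A :: "real^'n^'n"
  assumes "\<And>x y. x \<bullet> (A *v y) = (A *v x) \<bullet> y"
  shows "transpose A = A"
proof -
  have "(transpose A *v x) \<bullet> y = (A *v x) \<bullet> y" for x y
    using assms inner_matrix_vector_right[of x A y] by simp
  then show ?thesis
    by (metis matrix_eq vector_eq_rdot)
qed

section \<open>Existence and uniqueness of the Moore-Penrose inverse\<close>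

definition is_mp_inverse :: "real^'n^'m \<Rightarrow> real^'m^'n \<Rightarrow> bool" where
  "is_mp_inverse A B \<longleftrightarrow> A ** B ** A = A \<and> B ** A ** B = B \<and>
     transpose (A ** B) = A ** B \<and> transpose (B ** A) = B ** A"

text \<open>With \<open>B\<close> the matrix of the least-squares map, \<open>A ** B\<close> is the
  orthogonal projection onto the range of \<open>A\<close> and \<open>B ** A\<close> the one onto
  the range of the transpose. The four Penrose identities express exactly this.\<close>

lemma is_mp_inverse_exists:
  fixes A :: "real^'n^'m"
  shows "is_mp_inverse A (matrix (lsq_solution A))"
proof -
  define B where "B = matrix (lsq_solution A)"
  have B: "B *v y = lsq_solution A y" for y
    by (simp add: B_def linear_lsq_solution)
  have ABA: "A *v (B *v (A *v x)) = A *v x" for x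
  proof -
    have "transpose A *v (A *v (B *v (A *v x) - x)) = 0"
      using lsq_solution(2)[of A "A *v x"] by (simp add: B matrix_vector_mult_diff_distrib)
    from gram_kernel[OF this] show ?thesis
      by (simp add: matrix_vector_mult_diff_distrib)
  qed
  have BAB: "B *v (A *v (B *v y)) = B *v y" for y
    unfolding B using lsq_solution[of A y] by (intro lsq_solution_unique) auto
  \<comment> \<open>The left-hand side is symmetric in \<open>x\<close> and \<open>y\<close>, hence
    so is the right-hand side; this is the symmetry of \<open>A ** B\<close>. The fact
    \<open>BAs\<close> serves \<open>B ** A\<close> in the same way.\<close>
  have ABs: "(A *v (B *v x)) \<bullet> (A *v (B *v y)) = (A *v (B *v x)) \<bullet> y" for x y
    using inner_matrix_vector_right[of y A "B *v x"]
          inner_matrix_vector_right[of "A *v (B *v y)" A "B *v x"] lsq_solution(2)[of A y]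
    by (simp add: B inner_commute)
  have BAs: "(B *v (A *v x)) \<bullet> (B *v (A *v y)) = (B *v (A *v x)) \<bullet> y" for x y
  proof -
    obtain w where w: "B *v (A *v x) = transpose A *v w"
      using lsq_solution(1)[of A "A *v x"] unfolding B by blast
    show ?thesis
      unfolding w using ABA[of y] by (simp only: inner_matrix_vector_right[symmetric])
  qed
  have "A ** B ** A = A" "B ** A ** B = B"
    using ABA BAB by (simp_all add: matrix_eq matrix_vector_mul_assoc[symmetric])
  moreover have "transpose (A ** B) = A ** B"
    by (rule transpose_eq_selfI) (metis (no_types) ABs inner_commute matrix_vector_mul_assoc)
  moreover have "transpose (B ** A) = B ** A"
    by (rule transpose_eq_selfI) (metis (no_types) BAs inner_commute matrix_vector_mul_assoc)
  ultimately show ?thesis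
    by (simp add: is_mp_inverse_def B_def)
qed

text \<open>Since \<open>A ** C ** A = A\<close>, the product of \<open>A ** C\<close> and
  \<open>A ** B\<close> is \<open>A ** B\<close>; transposing it reverses the factors and yields
  \<open>A ** C\<close>. The same argument on the other side gives \<open>B ** A = C ** A\<close>,
  and then B = BAB = BAC = CAC = C.\<close>

lemma is_mp_inverse_unique:
  assumes B: "is_mp_inverse A B" and C: "is_mp_inverse A C"
  shows "B = C"
proof -
  note b = B[unfolded is_mp_inverse_def] and c = C[unfolded is_mp_inverse_def]
  have "A ** B = transpose ((A ** C) ** (A ** B))"
    using b c by (simp add: matrix_mul_assoc)
  also have "\<dots> = (A ** B) ** (A ** C)"
    using b c by (simp add: matrix_transpose_mul)
  finally have AB: "A ** B = A ** C"
    using b by (simp add: matrix_mul_assoc)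
  have "B ** A = transpose ((B ** A) ** (C ** A))"
    using b c by (simp flip: matrix_mul_assoc)
  also have "\<dots> = (C ** A) ** (B ** A)"
    using b c by (simp add: matrix_transpose_mul)
  also have "\<dots> = C ** (A ** B ** A)"
    by (simp add: matrix_mul_assoc)
  finally have BA: "B ** A = C ** A"
    using b by simp
  have "B = B ** (A ** B)"
    using b by (simp add: matrix_mul_assoc)
  also have "\<dots> = (B ** A) ** C"
    by (simp add: AB matrix_mul_assoc)
  also have "\<dots> = C"
    using c by (simp add: BA)
  finally show ?thesis .
qed

lemma mp_inverse_cancel: "A ** mp_inverse A ** A = A"
proof -
  have "is_mp_inverse A (mp_inverse A)"
    unfolding mp_inverse_def is_mp_inverse_def[symmetric]
    by (rule theI[where a = "matrix (lsq_solution A)"])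
       (blast intro: is_mp_inverse_exists is_mp_inverse_unique)+
  then show ?thesis
    by (simp add: is_mp_inverse_def)
qed

text \<open>The identity \<open>A ** B ** A = A\<close> makes \<open>A ** B\<close> fix the range of
  \<open>A\<close> pointwise. In this form the inverse enters the first-order condition.\<close>

lemma mp_inverse_range:
  assumes "y \<in> mat_range A"
  shows "A *v (mp_inverse A *v y) = y"
  using assms mp_inverse_cancel[of A]
  by (auto simp: mat_range_def matrix_vector_mul_assoc)

subsection \<open>Conditional expectation given past returns\<close>

locale market = prob_space M for M :: "'a measure" +
  fixes N :: nat and s :: "nat \<Rightarrow> real" and e :: "nat \<Rightarrow> 'a \<Rightarrow> real^'m"
  assumes indep_e: "indep_vars (\<lambda>_. borel) e {..<N}"
    and square_integrable_e: "\<And>k. k < N \<Longrightarrow> integrable M (\<lambda>\<omega>. (norm (e k \<omega>))\<^sup>2)"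
begin

abbreviation F :: "nat \<Rightarrow> 'a measure" where
  "F k \<equiv> filt M e k"

abbreviation Ex :: "nat \<Rightarrow> 'a \<Rightarrow> real^'m" where
  "Ex k \<equiv> excess s e k"

abbreviation C :: "nat \<Rightarrow> real^'m^'m" where
  "C k \<equiv> cov_matrix M (Ex k)"

abbreviation mean :: "nat \<Rightarrow> real^'m" where
  "mean k \<equiv> integral\<^sup>L M (Ex k)"

section \<open>The past sigma-algebras and their independence of the present return\<close>

lemma measurable_e [measurable]: "k < N \<Longrightarrow> e k \<in> borel_measurable M"
  using indep_e by (auto simp: indep_vars_def)

lemma space_F [simp]: "space (F k) = space M"
  by (auto simp: filt_def intro!: space_measure_of)

lemma sets_F: "sets (F k) = sigma_sets (space M) {e l -` A \<inter> space M | l A. l < k \<and> A \<in> sets borel}"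
  unfolding filt_def by (rule sets_measure_of) auto

lemma subalgebra_F:
  assumes "k \<le> N"
  shows "subalgebra M (F k)"
proof -
  have "{e l -` A \<inter> space M | l A. l < k \<and> A \<in> sets borel} \<subseteq> sets M"
    using assms by (auto intro!: measurable_sets[OF measurable_e])
  then show ?thesis
    unfolding subalgebra_def sets_F by (simp add: sets.sigma_sets_subset)
qed

lemma measurable_F_imp: "k \<le> N \<Longrightarrow> f \<in> measurable (F k) S \<Longrightarrow> f \<in> measurable M S"
  by (rule measurable_from_subalg[OF subalgebra_F])

lemma subalgebra_F_mono: "j \<le> k \<Longrightarrow> subalgebra (F k) (F j)"
  unfolding subalgebra_def sets_F by (auto intro!: sigma_sets_mono' intro: less_le_trans)

lemma measurable_F_mono: "j \<le> k \<Longrightarrow> f \<in> measurable (F j) S \<Longrightarrow> f \<in> measurable (F k) S"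
  by (rule measurable_from_subalg[OF subalgebra_F_mono])

lemma measurable_e_F: "l < k \<Longrightarrow> e l \<in> borel_measurable (F k)"
  by (rule measurableI) (auto simp: sets_F intro!: sigma_sets.Basic)

lemma sigma_finite_F: "k \<le> N \<Longrightarrow> sigma_finite_subalgebra M (F k)"
  by (intro finite_measure_subalgebra_is_sigma_finite)
     (simp add: finite_measure_subalgebra_def finite_measure_axioms
        finite_measure_subalgebra_axioms_def subalgebra_F)

text \<open>Joint independence passes to the sigma-algebras generated by disjoint blocks of indices,
  because the families of preimages are stable under intersection.\<close>

lemma indep_past_return:
  assumes k: "k < N"
  shows "indep_set (sets (F k)) (sigma_sets (space M) {e k -` A \<inter> space M | A. A \<in> sets borel})"
proof -
  \<comment> \<open>Two blocks indexed by \<open>bool\<close>: the past for \<open>True\<close>, the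
    single time \<open>k\<close> for \<open>False\<close>.\<close>
  define I :: "bool \<Rightarrow> nat set" where "I = case_bool {..<k} {k}"
  define G where "G = (\<lambda>l. {e l -` A \<inter> space M | A. A \<in> sets borel})"
  have "indep_sets G {..<N}"
    using indep_e by (simp add: indep_vars_def2 G_def)
  then have G: "indep_sets G (\<Union>b\<in>UNIV. I b)"
    by (rule indep_sets_mono_index[rotated]) (use k in \<open>auto simp: I_def split: bool.splits\<close>)
  have "indep_sets (\<lambda>b. sigma_sets (space M) (\<Union>l\<in>I b. G l)) UNIV"
  proof (rule indep_sets_collect_sigma[OF G])
    show "Int_stable (G l)" for l
      unfolding G_def Int_stable_def
    proof safe
      fix A B :: "(real^'m) set" assume "A \<in> sets borel" "B \<in> sets borel"
      then show "\<exists>D. e l -` A \<inter> space M \<inter> (e l -` B \<inter> space M) = e l -` D \<inter> space M \<and> D \<in> sets borel"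
        by (intro exI[of _ "A \<inter> B"]) auto
    qed
    show "disjoint_family_on I UNIV"
      by (auto simp: disjoint_family_on_def I_def split: bool.splits)
  qed
  also have "(\<lambda>b. sigma_sets (space M) (\<Union>l\<in>I b. G l)) =
    case_bool (sets (F k)) (sigma_sets (space M) {e k -` A \<inter> space M | A. A \<in> sets borel})"
  proof
    fix b
    have *: "(\<Union>l\<in>{..<k}. G l) = {e l -` A \<inter> space M | l A. l < k \<and> A \<in> sets borel}"
      by (auto simp: G_def)
    show "sigma_sets (space M) (\<Union>l\<in>I b. G l) =
      case_bool (sets (F k)) (sigma_sets (space M) {e k -` A \<inter> space M | A. A \<in> sets borel}) b"
    proof (cases b)
      case True
      then show ?thesis
        by (simp add: I_def sets_F *)
    next
      case False
      then show ?thesis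
        by (simp add: I_def G_def)
    qed
  qed
  finally show ?thesis
    by (simp add: indep_set_def)
qed

text \<open>Both variables generate sub-sigma-algebras of the two independent ones, and independence
  is inherited.\<close>

lemma indep_var_past_return:
  assumes k: "k < N" and Y: "Y \<in> borel_measurable (F k)" and \<phi>: "\<phi> \<in> borel_measurable borel"
  shows "indep_var borel (\<lambda>\<omega>. \<phi> (e k \<omega>)) borel (Y :: 'a \<Rightarrow> real)"
proof -
  have "{Y -` A \<inter> space M | A. A \<in> sets borel} \<subseteq> sets (F k)"
    using measurable_sets[OF Y] by auto
  from sets.sigma_sets_subset[OF this]
  have sY: "sigma_sets (space M) {Y -` A \<inter> space M | A. A \<in> sets borel} \<subseteq> sets (F k)"
    by simp
  have "{(\<lambda>\<omega>. \<phi> (e k \<omega>)) -` A \<inter> space M | A. A \<in> sets borel}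
      \<subseteq> {e k -` A \<inter> space M | A. A \<in> sets borel}"
  proof safe
    fix A :: "real set" assume "A \<in> sets borel"
    then have "\<phi> -` A \<in> sets borel"
      using measurable_sets[OF \<phi>] by simp
    moreover have "(\<lambda>\<omega>. \<phi> (e k \<omega>)) -` A = e k -` (\<phi> -` A)"
      by auto
    ultimately show "\<exists>B. (\<lambda>\<omega>. \<phi> (e k \<omega>)) -` A \<inter> space M = e k -` B \<inter> space M \<and> B \<in> sets borel"
      by metis
  qed
  from sigma_sets_mono'[OF this, of "space M"]
  have s\<phi>: "sigma_sets (space M) {(\<lambda>\<omega>. \<phi> (e k \<omega>)) -` A \<inter> space M | A. A \<in> sets borel}
      \<subseteq> sigma_sets (space M) {e k -` A \<inter> space M | A. A \<in> sets borel}" .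
  note ind = indep_past_return[OF k, unfolded indep_sets2_eq]
  show ?thesis
    unfolding indep_var_eq indep_sets2_eq
  proof (intro conjI ballI)
    show "random_variable borel Y"
      by (rule measurable_F_imp[OF _ Y]) (use k in simp)
    show "random_variable borel (\<lambda>\<omega>. \<phi> (e k \<omega>))"
      by (rule measurable_compose[OF measurable_e[OF k] \<phi>])
    show "sigma_sets (space M) {(\<lambda>\<omega>. \<phi> (e k \<omega>)) -` A \<inter> space M | A. A \<in> sets borel} \<subseteq> events"
      using s\<phi> ind by (meson order_trans)
    show "sigma_sets (space M) {Y -` A \<inter> space M | A. A \<in> sets borel} \<subseteq> events"
      using sY ind by (meson order_trans)
  next
    fix a b
    assume "a \<in> sigma_sets (space M) {(\<lambda>\<omega>. \<phi> (e k \<omega>)) -` A \<inter> space M | A. A \<in> sets borel}"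
      and "b \<in> sigma_sets (space M) {Y -` A \<inter> space M | A. A \<in> sets borel}"
    with s\<phi> sY have "a \<in> sigma_sets (space M) {e k -` A \<inter> space M | A. A \<in> sets borel}" "b \<in> sets (F k)"
      by (meson subsetD)+
    with ind have "prob (b \<inter> a) = prob b * prob a"
      by blast
    then show "prob (a \<inter> b) = prob a * prob b"
      by (simp add: Int_commute mult.commute)
  qed
qed

text \<open>An explicit version \<open>g\<close> of the conditional expectation of \<open>f\<close>
  is bundled with the integrability and measurability side conditions, so that the rules below
  compose without exceptional null sets being tracked by hand.\<close>

definition has_cond_exp :: "nat \<Rightarrow> ('a \<Rightarrow> real) \<Rightarrow> ('a \<Rightarrow> real) \<Rightarrow> bool" where
  "has_cond_exp k f g \<longleftrightarrow> integrable M f \<and> integrable M g \<and> g \<in> borel_measurable (F k) \<and>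
     (AE \<omega> in M. real_cond_exp M (F k) f \<omega> = g \<omega>)"

lemma has_cond_exp_self:
  assumes "k \<le> N" "integrable M f" "f \<in> borel_measurable (F k)"
  shows "has_cond_exp k f f"
  using assms sigma_finite_subalgebra.real_cond_exp_F_meas[OF sigma_finite_F] by (simp add: has_cond_exp_def)

lemma has_cond_exp_add:
  assumes "k \<le> N" "has_cond_exp k f f'" "has_cond_exp k g g'"
  shows "has_cond_exp k (\<lambda>\<omega>. f \<omega> + g \<omega>) (\<lambda>\<omega>. f' \<omega> + g' \<omega>)"
proof -
  note a = assms(2,3)[unfolded has_cond_exp_def]
  have "AE \<omega> in M. real_cond_exp M (F k) (\<lambda>\<omega>. f \<omega> + g \<omega>) \<omega>
      = real_cond_exp M (F k) f \<omega> + real_cond_exp M (F k) g \<omega>"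
    using a assms(1) by (intro sigma_finite_subalgebra.real_cond_exp_add[OF sigma_finite_F]) auto
  with a show ?thesis
    by (auto simp: has_cond_exp_def)
qed

lemma has_cond_exp_mult:
  assumes "k \<le> N" "has_cond_exp k f g" "Y \<in> borel_measurable (F k)" "integrable M (\<lambda>\<omega>. Y \<omega> * f \<omega>)"
  shows "has_cond_exp k (\<lambda>\<omega>. Y \<omega> * f \<omega>) (\<lambda>\<omega>. Y \<omega> * g \<omega>)"
proof -
  note a = assms(2)[unfolded has_cond_exp_def]
  have f: "f \<in> borel_measurable M"
    using a by auto
  interpret sigma_finite_subalgebra M "F k"
    by (rule sigma_finite_F) fact
  have ae: "AE \<omega> in M. real_cond_exp M (F k) (\<lambda>\<omega>. Y \<omega> * f \<omega>) \<omega> = Y \<omega> * g \<omega>"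
    using real_cond_exp_mult[OF assms(3) f assms(4)] a by auto
  have Yg: "(\<lambda>\<omega>. Y \<omega> * g \<omega>) \<in> borel_measurable (F k)"
    using assms(3) a by auto
  moreover have "integrable M (\<lambda>\<omega>. Y \<omega> * g \<omega>)"
    by (rule integrable_cong_AE_imp[OF real_cond_exp_int(1)[OF assms(4)]])
       (use ae measurable_F_imp[OF assms(1) Yg] in auto)
  ultimately show ?thesis
    using ae assms(4) by (simp add: has_cond_exp_def)
qed

lemma has_cond_exp_cmult: "k \<le> N \<Longrightarrow> has_cond_exp k f g \<Longrightarrow> has_cond_exp k (\<lambda>\<omega>. c * f \<omega>) (\<lambda>\<omega>. c * g \<omega>)"
  by (rule has_cond_exp_mult) (auto simp: has_cond_exp_def)

lemma has_cond_exp_diff: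
  assumes "k \<le> N" "has_cond_exp k f f'" "has_cond_exp k g g'"
  shows "has_cond_exp k (\<lambda>\<omega>. f \<omega> - g \<omega>) (\<lambda>\<omega>. f' \<omega> - g' \<omega>)"
  using has_cond_exp_add[OF assms(1,2) has_cond_exp_cmult[OF assms(1,3), of "-1"]] by simp

lemma has_cond_exp_sum:
  assumes "k \<le> N" "\<And>i. i \<in> I \<Longrightarrow> has_cond_exp k (f i) (g i)"
  shows "has_cond_exp k (\<lambda>\<omega>. \<Sum>i\<in>I. f i \<omega>) (\<lambda>\<omega>. \<Sum>i\<in>I. g i \<omega>)"
  using assms(2)
  by (induction I rule: infinite_finite_induct)
     (auto intro!: has_cond_exp_add has_cond_exp_self assms(1))

lemma has_cond_exp_cong:
  assumes k: "k \<le> N" and "has_cond_exp k f g"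
    and "AE \<omega> in M. f \<omega> = f' \<omega>" "f' \<in> borel_measurable M"
    and "AE \<omega> in M. g \<omega> = g' \<omega>" "g' \<in> borel_measurable (F k)"
  shows "has_cond_exp k f' g'"
proof -
  note a = assms(2)[unfolded has_cond_exp_def]
  interpret sigma_finite_subalgebra M "F k"
    by (rule sigma_finite_F) fact
  have "AE \<omega> in M. real_cond_exp M (F k) f \<omega> = real_cond_exp M (F k) f' \<omega>"
    using a assms by (intro real_cond_exp_cong) auto
  moreover have "integrable M f'" "integrable M g'"
    using a assms measurable_F_imp[OF k] by (auto intro: integrable_cong_AE_imp AE_symmetric)
  ultimately show ?thesis
    using a assms by (auto simp: has_cond_exp_def)
qed

lemma has_cond_exp_tower:
  assumes "j \<le> k" "k \<le> N" "has_cond_exp k f g" "has_cond_exp j g h"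
  shows "has_cond_exp j f h"
proof -
  note a = assms(3,4)[unfolded has_cond_exp_def]
  have j: "j \<le> N" using assms by simp
  interpret sigma_finite_subalgebra M "F j"
    by (rule sigma_finite_F) fact
  have "AE \<omega> in M. real_cond_exp M (F j) (real_cond_exp M (F k) f) \<omega> = real_cond_exp M (F j) f \<omega>"
    using a assms by (intro real_cond_exp_nested_subalg subalgebra_F subalgebra_F_mono) auto
  moreover have "AE \<omega> in M. real_cond_exp M (F j) (real_cond_exp M (F k) f) \<omega> = real_cond_exp M (F j) g \<omega>"
    using a by (intro real_cond_exp_cong) auto
  ultimately show ?thesis
    using a by (auto simp: has_cond_exp_def)
qed

text \<open>The defining integrals are checked over each \<open>A\<close> in \<open>F k\<close>: the
  indicator of \<open>A\<close> times \<open>Y\<close> is still measurable with respect to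
  \<open>F k\<close>, hence independent of \<open>\<phi> (e k \<omega>)\<close>, and the expectation
  of the product factorises.\<close>

lemma has_cond_exp_indep:
  assumes k: "k < N" and Y: "Y \<in> borel_measurable (F k)" "integrable M Y"
    and \<phi>: "\<phi> \<in> borel_measurable borel" "integrable M (\<lambda>\<omega>. \<phi> (e k \<omega>))"
  shows "has_cond_exp k (\<lambda>\<omega>. \<phi> (e k \<omega>) * Y \<omega>) (\<lambda>\<omega>. (\<integral>\<omega>. \<phi> (e k \<omega>) \<partial>M) * Y \<omega>)"
proof -
  have kN: "k \<le> N" using k by simp
  interpret sigma_finite_subalgebra M "F k"
    by (rule sigma_finite_F) fact
  have int: "integrable M (\<lambda>\<omega>. \<phi> (e k \<omega>) * Y \<omega>)"
    by (rule indep_var_integrable[OF indep_var_past_return[OF k Y(1) \<phi>(1)] \<phi>(2) Y(2)])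
  have "AE \<omega> in M. real_cond_exp M (F k) (\<lambda>\<omega>. \<phi> (e k \<omega>) * Y \<omega>) \<omega>
      = (\<integral>\<omega>. \<phi> (e k \<omega>) \<partial>M) * Y \<omega>"
  proof (rule real_cond_exp_charact[OF _ int])
    fix A assume A: "A \<in> sets (F k)"
    then have AM: "A \<in> sets M"
      using subalgebra_F[OF kN] by (auto simp: subalgebra_def)
    have iY: "(\<lambda>\<omega>. indicator A \<omega> * Y \<omega>) \<in> borel_measurable (F k)"
      using A Y(1) by measurable
    have iYi: "integrable M (\<lambda>\<omega>. indicator A \<omega> * Y \<omega>)"
      using integrable_mult_indicator[OF AM Y(2)] by simp
    have "(\<integral>\<omega>\<in>A. \<phi> (e k \<omega>) * Y \<omega> \<partial>M) = (\<integral>\<omega>. \<phi> (e k \<omega>) * (indicator A \<omega> * Y \<omega>) \<partial>M)"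
      by (simp add: set_lebesgue_integral_def ac_simps)
    also have "\<dots> = (\<integral>\<omega>. \<phi> (e k \<omega>) \<partial>M) * (\<integral>\<omega>. indicator A \<omega> * Y \<omega> \<partial>M)"
      by (rule indep_var_lebesgue_integral[OF indep_var_past_return[OF k iY \<phi>(1)] \<phi>(2) iYi])
    also have "\<dots> = (\<integral>\<omega>\<in>A. (\<integral>\<omega>. \<phi> (e k \<omega>) \<partial>M) * Y \<omega> \<partial>M)"
      by (simp add: set_lebesgue_integral_def)
    finally show "(\<integral>\<omega>\<in>A. \<phi> (e k \<omega>) * Y \<omega> \<partial>M) = (\<integral>\<omega>\<in>A. (\<integral>\<omega>. \<phi> (e k \<omega>) \<partial>M) * Y \<omega> \<partial>M)" .
  qed (use Y in auto)
  with int Y show ?thesis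
    by (simp add: has_cond_exp_def)
qed

section \<open>Square-integrable adapted variables\<close>

lemma L2F_I:
  fixes f :: "'a \<Rightarrow> 'b::euclidean_space"
  assumes "k \<le> N" "f \<in> borel_measurable (F k)" "integrable M g"
    and "\<And>\<omega>. (norm (f \<omega>))\<^sup>2 \<le> g \<omega>"
  shows "f \<in> L2F M e k"
proof -
  have f: "f \<in> borel_measurable M"
    by (rule measurable_F_imp[OF assms(1,2)])
  have "integrable M (\<lambda>\<omega>. (norm (f \<omega>))\<^sup>2)"
  proof (rule Bochner_Integration.integrable_bound[OF assms(3)])
    show "AE \<omega> in M. norm ((norm (f \<omega>))\<^sup>2) \<le> norm (g \<omega>)"
      using order_trans[OF assms(4) abs_ge_self] by (intro AE_I2) simp
  qed (use f in measurable)
  with assms show ?thesis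
    by (simp add: L2F_def)
qed

lemma L2F_measurable: "f \<in> L2F M e k \<Longrightarrow> f \<in> borel_measurable (F k)"
  by (simp add: L2F_def)

lemma L2F_add:
  fixes f g :: "'a \<Rightarrow> 'b::euclidean_space"
  assumes "k \<le> N" "f \<in> L2F M e k" "g \<in> L2F M e k"
  shows "(\<lambda>\<omega>. f \<omega> + g \<omega>) \<in> L2F M e k"
proof (rule L2F_I[where g = "\<lambda>\<omega>. 2 * (norm (f \<omega>))\<^sup>2 + 2 * (norm (g \<omega>))\<^sup>2"])
  fix \<omega>
  have "(norm (f \<omega> + g \<omega>))\<^sup>2 \<le> (norm (f \<omega>) + norm (g \<omega>))\<^sup>2"
    by (intro power_mono norm_triangle_ineq) auto
  also have "\<dots> \<le> 2 * (norm (f \<omega>))\<^sup>2 + 2 * (norm (g \<omega>))\<^sup>2"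
    using zero_le_power2[of "norm (f \<omega>) - norm (g \<omega>)"] by (simp add: power2_eq_square algebra_simps)
  finally show "(norm (f \<omega> + g \<omega>))\<^sup>2 \<le> 2 * (norm (f \<omega>))\<^sup>2 + 2 * (norm (g \<omega>))\<^sup>2" .
qed (use assms in \<open>auto simp: L2F_def\<close>)

lemma L2F_const: "k \<le> N \<Longrightarrow> (\<lambda>_. c) \<in> L2F M e k"
  by (simp add: L2F_def)

lemma L2F_bounded_linear:
  fixes f :: "'a \<Rightarrow> 'b::euclidean_space" and T :: "'b \<Rightarrow> 'c::euclidean_space"
  assumes "k \<le> N" "f \<in> L2F M e k" and T: "bounded_linear T"
  shows "(\<lambda>\<omega>. T (f \<omega>)) \<in> L2F M e k"
proof -
  obtain K where K: "\<And>x. norm (T x) \<le> norm x * K"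
    using bounded_linear.bounded[OF T] by blast
  have "T \<in> borel_measurable borel"
    by (intro borel_measurable_continuous_onI linear_continuous_on T)
  then show ?thesis
    using assms(1,2) power_mono[OF K norm_ge_zero, of _ 2]
    by (intro L2F_I[where g = "\<lambda>\<omega>. (norm (f \<omega>))\<^sup>2 * K\<^sup>2"])
       (auto simp: L2F_def power_mult_distrib)
qed

lemma L2F_mono: "j \<le> k \<Longrightarrow> f \<in> L2F M e j \<Longrightarrow> f \<in> L2F M e k"
  by (auto simp: L2F_def intro: measurable_F_mono)

lemma L2F_mult_integrable:
  fixes f g :: "'a \<Rightarrow> real"
  assumes "k \<le> N" "f \<in> L2F M e k" "g \<in> L2F M e k"
  shows "integrable M (\<lambda>\<omega>. f \<omega> * g \<omega>)"
proof (rule Bochner_Integration.integrable_bound)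
  show "integrable M (\<lambda>\<omega>. (f \<omega>)\<^sup>2 + (g \<omega>)\<^sup>2)"
    using assms by (simp add: L2F_def)
  show "(\<lambda>\<omega>. f \<omega> * g \<omega>) \<in> borel_measurable M"
    using assms by (intro borel_measurable_times measurable_F_imp[OF assms(1)]) (auto simp: L2F_def)
  have "\<bar>f \<omega> * g \<omega>\<bar> \<le> (f \<omega>)\<^sup>2 + (g \<omega>)\<^sup>2" for \<omega>
    using zero_le_power2[of "\<bar>f \<omega>\<bar> - \<bar>g \<omega>\<bar>"] mult_nonneg_nonneg[OF abs_ge_zero abs_ge_zero, of "f \<omega>" "g \<omega>"]
    by (simp only: power2_diff abs_mult power2_abs)
  then show "AE \<omega> in M. norm (f \<omega> * g \<omega>) \<le> norm ((f \<omega>)\<^sup>2 + (g \<omega>)\<^sup>2)"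
    by simp
qed

lemma L2F_integrable:
  fixes f :: "'a \<Rightarrow> real"
  assumes "k \<le> N" "f \<in> L2F M e k"
  shows "integrable M f"
  using L2F_mult_integrable[OF assms L2F_const[OF assms(1), of 1]] by simp

text \<open>A product of square-integrable variables is in general only integrable; here
  independence makes the product of the squares integrable. This keeps wealth square-integrable
  although returns are multiplied by random controls.\<close>

lemma L2F_mult_indep:
  fixes f :: "'a \<Rightarrow> real"
  assumes k: "k < N" and f: "f \<in> L2F M e k" and \<phi>: "\<phi> \<in> borel_measurable borel"
    and \<phi>2: "integrable M (\<lambda>\<omega>. (\<phi> (e k \<omega>))\<^sup>2)"
  shows "(\<lambda>\<omega>. \<phi> (e k \<omega>) * f \<omega>) \<in> L2F M e (Suc k)"
proof (rule L2F_I)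
  have "has_cond_exp k (\<lambda>\<omega>. (\<phi> (e k \<omega>))\<^sup>2 * (f \<omega>)\<^sup>2) (\<lambda>\<omega>. (\<integral>\<omega>. (\<phi> (e k \<omega>))\<^sup>2 \<partial>M) * (f \<omega>)\<^sup>2)"
    by (rule has_cond_exp_indep[OF k, of "\<lambda>\<omega>. (f \<omega>)\<^sup>2" "\<lambda>y. (\<phi> y)\<^sup>2"]) (use f \<phi> \<phi>2 in \<open>auto simp: L2F_def\<close>)
  then show "integrable M (\<lambda>\<omega>. (\<phi> (e k \<omega>))\<^sup>2 * (f \<omega>)\<^sup>2)"
    by (simp add: has_cond_exp_def)
  show "(\<lambda>\<omega>. \<phi> (e k \<omega>) * f \<omega>) \<in> borel_measurable (F (Suc k))"
    using measurable_F_mono[OF _ L2F_measurable[OF f], of "Suc k"]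
      measurable_compose[OF measurable_e_F[of k "Suc k"] \<phi>] by auto
qed (use k in \<open>auto simp: power_mult_distrib\<close>)

section \<open>The centred excess return as noise, and its conditional moments\<close>

abbreviation D :: "nat \<Rightarrow> 'a \<Rightarrow> real^'m" where
  "D k \<omega> \<equiv> Ex k \<omega> - mean k"

lemma L2F_cmult:
  fixes f :: "'a \<Rightarrow> real"
  shows "k \<le> N \<Longrightarrow> f \<in> L2F M e k \<Longrightarrow> (\<lambda>\<omega>. c * f \<omega>) \<in> L2F M e k"
  by (rule L2F_bounded_linear) (auto intro: bounded_linear_mult_right)

lemma L2F_inner_const:
  fixes f :: "'a \<Rightarrow> 'b::euclidean_space"
  shows "k \<le> N \<Longrightarrow> f \<in> L2F M e k \<Longrightarrow> (\<lambda>\<omega>. c \<bullet> f \<omega>) \<in> L2F M e k"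
  by (rule L2F_bounded_linear) (auto intro: bounded_linear_inner_right)

lemma L2F_nth:
  fixes f :: "'a \<Rightarrow> real^'n"
  shows "k \<le> N \<Longrightarrow> f \<in> L2F M e k \<Longrightarrow> (\<lambda>\<omega>. f \<omega> $ i) \<in> L2F M e k"
  by (rule L2F_bounded_linear) (auto intro: bounded_linear_vec_nth)

lemma L2F_scaleR_const:
  fixes f :: "'a \<Rightarrow> 'b::euclidean_space"
  shows "k \<le> N \<Longrightarrow> f \<in> L2F M e k \<Longrightarrow> (\<lambda>\<omega>. c *\<^sub>R f \<omega>) \<in> L2F M e k"
  by (rule L2F_bounded_linear) (auto intro: bounded_linear_scaleR_right)

lemma L2F_diff:
  fixes f g :: "'a \<Rightarrow> 'b::euclidean_space"
  assumes "k \<le> N" "f \<in> L2F M e k" "g \<in> L2F M e k"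
  shows "(\<lambda>\<omega>. f \<omega> - g \<omega>) \<in> L2F M e k"
  using L2F_add[OF assms(1,2) L2F_scaleR_const[OF assms(1,3), of "-1"]] by simp

lemma L2F_sum:
  fixes f :: "'i \<Rightarrow> 'a \<Rightarrow> 'b::euclidean_space"
  assumes "k \<le> N" "\<And>i. i \<in> I \<Longrightarrow> f i \<in> L2F M e k"
  shows "(\<lambda>\<omega>. \<Sum>i\<in>I. f i \<omega>) \<in> L2F M e k"
  using assms(2) by (induction I rule: infinite_finite_induct) (auto intro!: L2F_add L2F_const assms(1))

lemma excess_eq: "Ex k \<omega> = e k \<omega> - (\<chi> i. s k)"
  by (simp add: excess_def vec_eq_iff)

lemma L2F_excess:
  assumes "k < N"
  shows "Ex k \<in> L2F M e (Suc k)"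
proof -
  have "e k \<in> L2F M e (Suc k)"
    using assms by (simp add: L2F_def measurable_e_F square_integrable_e)
  from L2F_diff[OF _ this L2F_const, of "\<chi> i. s k"] assms show ?thesis
    unfolding excess_eq[abs_def] by simp
qed

lemma integrable_excess:
  assumes k: "k < N"
  shows "integrable M (Ex k)"
proof (rule Bochner_Integration.integrable_bound)
  have *: "Ex k \<in> borel_measurable (F (Suc k))" "integrable M (\<lambda>\<omega>. (norm (Ex k \<omega>))\<^sup>2)"
    using L2F_excess[OF k] by (simp_all add: L2F_def)
  show "integrable M (\<lambda>\<omega>. 1 + (norm (Ex k \<omega>))\<^sup>2)"
    using *(2) by simp
  show "Ex k \<in> borel_measurable M"
    by (rule measurable_F_imp[OF _ *(1)]) (use k in simp)
  have "norm x \<le> 1 + (norm x)\<^sup>2" for x :: "real^'m"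
    using zero_le_power2[of "norm x - 1"] norm_ge_zero[of x]
    by (simp add: power2_diff del: norm_ge_zero)
  then show "AE \<omega> in M. norm (Ex k \<omega>) \<le> norm (1 + (norm (Ex k \<omega>))\<^sup>2)"
    by (intro AE_I2) (simp add: order_trans[OF _ abs_ge_self])
qed

lemma L2F_noise: "k < N \<Longrightarrow> D k \<in> L2F M e (Suc k)"
  by (intro L2F_diff L2F_const L2F_excess) auto

lemma measurable_noise_nth [measurable]:
  "(\<lambda>y. (y - (\<chi> i. s k) - mean k) $ i) \<in> borel_measurable borel"
  by (intro borel_measurable_continuous_onI continuous_intros)

text \<open>Displays a noise coordinate as a Borel function of \<open>e k\<close>, the form to which
  the independence rules apply.\<close>

lemma noise_nth: "D k \<omega> $ i = (\<lambda>y. (y - (\<chi> i. s k) - mean k) $ i) (e k \<omega>)"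
  by (simp add: excess_eq)

lemma L2F_noise_mult:
  assumes k: "k < N" and f: "f \<in> L2F M e k"
  shows "(\<lambda>\<omega>. D k \<omega> $ i * f \<omega>) \<in> L2F M e (Suc k)"
  unfolding noise_nth
proof (rule L2F_mult_indep[OF k f])
  show "integrable M (\<lambda>\<omega>. ((e k \<omega> - (\<chi> i. s k) - mean k) $ i)\<^sup>2)"
    using L2F_nth[OF _ L2F_noise[OF k], of i] k by (simp add: L2F_def excess_eq)
qed (rule measurable_noise_nth)

lemma L2F_noise_inner:
  assumes k: "k < N" and a: "a \<in> L2F M e k"
  shows "(\<lambda>\<omega>. D k \<omega> \<bullet> a \<omega>) \<in> L2F M e (Suc k)"
  unfolding inner_vec_def inner_real_def
  by (intro L2F_sum L2F_noise_mult L2F_nth) (use k a in auto)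

lemma L2F_excess_inner:
  assumes k: "k < N" and a: "a \<in> L2F M e k"
  shows "(\<lambda>\<omega>. Ex k \<omega> \<bullet> a \<omega>) \<in> L2F M e (Suc k)"
proof -
  have "(\<lambda>\<omega>. D k \<omega> \<bullet> a \<omega> + mean k \<bullet> a \<omega>) \<in> L2F M e (Suc k)"
    using k a by (intro L2F_add L2F_noise_inner L2F_mono[OF _ L2F_inner_const, of k]) auto
  then show ?thesis
    by (simp add: inner_diff_left)
qed

lemma integral_noise:
  assumes "k < N"
  shows "(\<integral>\<omega>. D k \<omega> $ i \<partial>M) = 0"
proof -
  have "(\<integral>\<omega>. D k \<omega> $ i \<partial>M) = (\<integral>\<omega>. D k \<omega> \<partial>M) $ i"
    using integral_bounded_linear[OF bounded_linear_vec_nth, of M "D k" i] integrable_excess[OF assms]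
    by simp
  also have "(\<integral>\<omega>. D k \<omega> \<partial>M) = 0"
    using integrable_excess[OF assms] by (simp add: prob_space)
  finally show ?thesis
    by simp
qed

lemma has_cond_exp_noise:
  assumes k: "k < N" and a: "a \<in> L2F M e k"
  shows "has_cond_exp k (\<lambda>\<omega>. D k \<omega> \<bullet> a \<omega>) (\<lambda>_. 0)"
proof -
  have "has_cond_exp k (\<lambda>\<omega>. \<Sum>i\<in>UNIV. D k \<omega> $ i * a \<omega> $ i) (\<lambda>\<omega>. \<Sum>i\<in>(UNIV::'m set). 0)"
  proof (rule has_cond_exp_sum)
    fix i :: 'm
    have ai: "(\<lambda>\<omega>. a \<omega> $ i) \<in> L2F M e k"
      using L2F_nth[OF _ a] k by simp
    have "has_cond_exp k (\<lambda>\<omega>. D k \<omega> $ i * a \<omega> $ i) (\<lambda>\<omega>. (\<integral>\<omega>. D k \<omega> $ i \<partial>M) * a \<omega> $ i)"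
      unfolding noise_nth
    proof (rule has_cond_exp_indep[OF k L2F_measurable[OF ai] L2F_integrable[OF _ ai]])
      show "integrable M (\<lambda>\<omega>. (e k \<omega> - (\<chi> i. s k) - mean k) $ i)"
        using L2F_integrable[OF _ L2F_nth[OF _ L2F_noise[OF k], of i]] k by (simp add: excess_eq)
    qed (use k in \<open>auto intro: measurable_noise_nth\<close>)
    then show "has_cond_exp k (\<lambda>\<omega>. D k \<omega> $ i * a \<omega> $ i) (\<lambda>\<omega>. 0)"
      by (simp only: integral_noise[OF k] mult_zero_left)
  qed (use k in simp)
  then show ?thesis
    by (simp add: inner_vec_def)
qed

lemma has_cond_exp_mult_noise:
  assumes k: "k < N" and Y: "Y \<in> L2F M e k" and a: "a \<in> L2F M e k"
  shows "has_cond_exp k (\<lambda>\<omega>. Y \<omega> * (D k \<omega> \<bullet> a \<omega>)) (\<lambda>_. 0)"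
  using has_cond_exp_mult[OF _ has_cond_exp_noise[OF k a] L2F_measurable[OF Y]
      L2F_mult_integrable[OF _ L2F_mono[OF _ Y, of "Suc k"] L2F_noise_inner[OF k a]]] k
  by simp

lemma has_cond_exp_excess:
  assumes k: "k < N" and a: "a \<in> L2F M e k"
  shows "has_cond_exp k (\<lambda>\<omega>. Ex k \<omega> \<bullet> a \<omega>) (\<lambda>\<omega>. mean k \<bullet> a \<omega>)"
proof -
  have kN: "k \<le> N"
    using k by simp
  have m: "(\<lambda>\<omega>. mean k \<bullet> a \<omega>) \<in> L2F M e k"
    by (rule L2F_inner_const[OF kN a])
  show ?thesis
    using has_cond_exp_add[OF kN has_cond_exp_noise[OF k a] has_cond_exp_self[OF kN L2F_integrable[OF kN m] L2F_measurable[OF m]]]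
    by (simp add: inner_diff_left)
qed

lemma has_cond_exp_noise_noise:
  assumes k: "k < N" and a: "a \<in> L2F M e k" and b: "b \<in> L2F M e k"
  shows "has_cond_exp k (\<lambda>\<omega>. (D k \<omega> \<bullet> a \<omega>) * (D k \<omega> \<bullet> b \<omega>)) (\<lambda>\<omega>. a \<omega> \<bullet> (C k *v b \<omega>))"
proof -
  have kN: "k \<le> N"
    using k by simp
  have "has_cond_exp k (\<lambda>\<omega>. \<Sum>i\<in>UNIV. \<Sum>j\<in>UNIV. (D k \<omega> $ i * D k \<omega> $ j) * (a \<omega> $ i * b \<omega> $ j))
             (\<lambda>\<omega>. \<Sum>i\<in>UNIV. \<Sum>j\<in>UNIV. C k $ i $ j * (a \<omega> $ i * b \<omega> $ j))"
  proof (intro has_cond_exp_sum[OF kN])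
    fix i j :: 'm
    have ai: "(\<lambda>\<omega>. a \<omega> $ i) \<in> L2F M e k" and bj: "(\<lambda>\<omega>. b \<omega> $ j) \<in> L2F M e k"
      using L2F_nth[OF kN a] L2F_nth[OF kN b] by simp_all
    have "has_cond_exp k (\<lambda>\<omega>. (D k \<omega> $ i * D k \<omega> $ j) * (a \<omega> $ i * b \<omega> $ j))
      (\<lambda>\<omega>. (\<integral>\<omega>. D k \<omega> $ i * D k \<omega> $ j \<partial>M) * (a \<omega> $ i * b \<omega> $ j))"
      unfolding noise_nth
    proof (rule has_cond_exp_indep[OF k, where \<phi> = "\<lambda>y. (y - (\<chi> i. s k) - mean k) $ i * (y - (\<chi> i. s k) - mean k) $ j"])
      show "(\<lambda>\<omega>. a \<omega> $ i * b \<omega> $ j) \<in> borel_measurable (F k)"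
        using L2F_measurable[OF ai] L2F_measurable[OF bj] by simp
      show "integrable M (\<lambda>\<omega>. a \<omega> $ i * b \<omega> $ j)"
        by (rule L2F_mult_integrable[OF kN ai bj])
      show "integrable M (\<lambda>\<omega>. (e k \<omega> - (\<chi> i. s k) - mean k) $ i * (e k \<omega> - (\<chi> i. s k) - mean k) $ j)"
        using L2F_mult_integrable[OF _ L2F_nth[OF _ L2F_noise[OF k], of i] L2F_nth[OF _ L2F_noise[OF k], of j]] k
        by (simp add: excess_eq)
      show "(\<lambda>y. (y - (\<chi> i. s k) - mean k) $ i * (y - (\<chi> i. s k) - mean k) $ j) \<in> borel_measurable borel"
        by (intro borel_measurable_times measurable_noise_nth)
    qed
    then show "has_cond_exp k (\<lambda>\<omega>. (D k \<omega> $ i * D k \<omega> $ j) * (a \<omega> $ i * b \<omega> $ j))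
      (\<lambda>\<omega>. C k $ i $ j * (a \<omega> $ i * b \<omega> $ j))"
      by (simp add: cov_matrix_def)
  qed
  moreover have "(\<Sum>i\<in>UNIV. \<Sum>j\<in>UNIV. (D k \<omega> $ i * D k \<omega> $ j) * (a \<omega> $ i * b \<omega> $ j))
      = (D k \<omega> \<bullet> a \<omega>) * (D k \<omega> \<bullet> b \<omega>)" for \<omega>
    unfolding inner_vec_def inner_real_def sum_product
    by (intro sum.cong refl) (simp only: ac_simps)
  moreover have "(\<Sum>i\<in>UNIV. \<Sum>j\<in>UNIV. C k $ i $ j * (a \<omega> $ i * b \<omega> $ j))
      = a \<omega> \<bullet> (C k *v b \<omega>)" for \<omega>
    unfolding inner_vec_def inner_real_def matrix_vector_mult_def vec_lambda_beta sum_distrib_left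
    by (intro sum.cong refl) (simp only: ac_simps)
  ultimately show ?thesis
    by simp
qed

section \<open>Expansion of the cost under a change of the control at one time\<close>

lemma has_cond_exp_affine:
  assumes k: "k < N" and X: "X \<in> L2F M e k" and u: "u \<in> L2F M e k"
    and Z: "has_cond_exp (Suc k) Z (\<lambda>\<omega>. \<alpha> * (s k * X \<omega> + Ex k \<omega> \<bullet> u \<omega>) + \<beta>)"
  shows "has_cond_exp k Z (\<lambda>\<omega>. \<alpha> * (s k * X \<omega> + mean k \<bullet> u \<omega>) + \<beta>)"
proof -
  have kN: "k \<le> N"
    using k by simp
  have self: "has_cond_exp k f f" if "f \<in> L2F M e k" for f :: "'a \<Rightarrow> real"
    by (rule has_cond_exp_self[OF kN L2F_integrable[OF kN that] L2F_measurable[OF that]])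
  have "has_cond_exp k (\<lambda>\<omega>. \<alpha> * (s k * X \<omega> + Ex k \<omega> \<bullet> u \<omega>) + \<beta>) (\<lambda>\<omega>. \<alpha> * (s k * X \<omega> + mean k \<bullet> u \<omega>) + \<beta>)"
    by (intro has_cond_exp_add has_cond_exp_cmult has_cond_exp_excess self L2F_const kN k X u)
  with Z show ?thesis
    using has_cond_exp_tower[of k "Suc k"] k by simp
qed

text \<open>Let \<zeta> be the conditional mean of \<open>Z\<close> at time \<open>k\<close> and
  \<eta> the centred part of the perturbation. Almost surely \<open>Z'\<close> minus its conditional
  mean is (Z - \<zeta>) + p \<eta>, so only the conditional moments of \<eta> Z, \<zeta> \<eta> and
  \<eta> squared are needed. The weight \<open>c\<close> stands for \<mu>1 X + \<mu>2 in the
  application.\<close>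

lemma cost_variation:
  fixes c :: "'a \<Rightarrow> real" and p :: real
  assumes k: "k < N" and X: "X \<in> L2F M e k" and u: "u \<in> L2F M e k" and d: "d \<in> L2F M e k"
    and Z2: "Z \<in> L2F M e N"
    and Z: "has_cond_exp (Suc k) Z (\<lambda>\<omega>. \<alpha> * (s k * X \<omega> + Ex k \<omega> \<bullet> u \<omega>) + \<beta>)"
  defines "E \<equiv> real_cond_exp M (F k)" and "Z' \<equiv> \<lambda>\<omega>. Z \<omega> + p * (Ex k \<omega> \<bullet> d \<omega>)"
  shows "AE \<omega> in M. E (\<lambda>\<omega>'. (Z' \<omega>' - E Z' \<omega>')\<^sup>2) \<omega> - c \<omega> * E Z' \<omega>
     = E (\<lambda>\<omega>'. (Z \<omega>' - E Z \<omega>')\<^sup>2) \<omega> - c \<omega> * E Z \<omega>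
       + (p\<^sup>2 * (d \<omega> \<bullet> (C k *v d \<omega>)) + 2 * \<alpha> * p * (u \<omega> \<bullet> (C k *v d \<omega>)) - c \<omega> * (p * (mean k \<bullet> d \<omega>)))"
proof -
  have kN: "k \<le> N" "Suc k \<le> N"
    using k by simp_all
  interpret sigma_finite_subalgebra M "F k"
    by (rule sigma_finite_F) fact
  define \<zeta> where "\<zeta> = (\<lambda>\<omega>. \<alpha> * (s k * X \<omega> + mean k \<bullet> u \<omega>) + \<beta>)"
  define \<eta> where "\<eta> = (\<lambda>\<omega>. D k \<omega> \<bullet> d \<omega>)"
  \<comment> \<open>The terms that remain when the square of Z - \<zeta> is subtracted from the
    square of (Z - \<zeta>) + p \<eta>.\<close>
  define Q where "Q = (\<lambda>\<omega>. 2 * p * (\<eta> \<omega> * Z \<omega> - \<zeta> \<omega> * \<eta> \<omega>) + p\<^sup>2 * (\<eta> \<omega> * \<eta> \<omega>))"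
  have \<zeta>2: "\<zeta> \<in> L2F M e k"
    unfolding \<zeta>_def by (intro L2F_add L2F_cmult L2F_inner_const L2F_const X u kN)
  have \<eta>2: "\<eta> \<in> L2F M e (Suc k)"
    unfolding \<eta>_def by (rule L2F_noise_inner[OF k d])
  have Z\<zeta>: "has_cond_exp k Z \<zeta>"
    unfolding \<zeta>_def by (rule has_cond_exp_affine[OF k X u Z])
  have Z'\<zeta>: "has_cond_exp k Z' (\<lambda>\<omega>. \<zeta> \<omega> + p * (mean k \<bullet> d \<omega>))"
    unfolding Z'_def by (intro has_cond_exp_add has_cond_exp_cmult has_cond_exp_excess Z\<zeta> kN k d)
  \<comment> \<open>The cross moment is computed in two stages: \<eta> is known at time
    \<open>Suc k\<close>, so \<open>Z\<close> may first be replaced by its affine conditional mean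
    there.\<close>
  have "has_cond_exp (Suc k) (\<lambda>\<omega>. \<eta> \<omega> * Z \<omega>) (\<lambda>\<omega>. \<eta> \<omega> * (\<alpha> * (s k * X \<omega> + Ex k \<omega> \<bullet> u \<omega>) + \<beta>))"
    by (rule has_cond_exp_mult[OF kN(2) Z L2F_measurable[OF \<eta>2]])
       (rule L2F_mult_integrable[OF order_refl L2F_mono[OF kN(2) \<eta>2] Z2])
  moreover have "has_cond_exp k (\<lambda>\<omega>. \<zeta> \<omega> * \<eta> \<omega> + \<alpha> * ((D k \<omega> \<bullet> u \<omega>) * \<eta> \<omega>))
      (\<lambda>\<omega>. 0 + \<alpha> * (u \<omega> \<bullet> (C k *v d \<omega>)))"
    unfolding \<eta>_def by (intro has_cond_exp_add has_cond_exp_cmult has_cond_exp_mult_noise has_cond_exp_noise_noise k kN u d \<zeta>2)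
  \<comment> \<open>The affine expression is \<zeta> plus \<alpha> times the noise in the direction
    \<open>u\<close>; the first part contributes nothing given \<open>F k\<close>, the second
    contributes the covariance.\<close>
  moreover have "\<eta> \<omega> * (\<alpha> * (s k * X \<omega> + Ex k \<omega> \<bullet> u \<omega>) + \<beta>)
      = \<zeta> \<omega> * \<eta> \<omega> + \<alpha> * ((D k \<omega> \<bullet> u \<omega>) * \<eta> \<omega>)" for \<omega>
    by (simp add: \<zeta>_def inner_diff_left algebra_simps)
  ultimately have \<eta>Z: "has_cond_exp k (\<lambda>\<omega>. \<eta> \<omega> * Z \<omega>) (\<lambda>\<omega>. \<alpha> * (u \<omega> \<bullet> (C k *v d \<omega>)))"
    using has_cond_exp_tower[of k "Suc k"] kN by simp
  have \<zeta>\<eta>: "has_cond_exp k (\<lambda>\<omega>. \<zeta> \<omega> * \<eta> \<omega>) (\<lambda>_. 0)"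
    unfolding \<eta>_def by (rule has_cond_exp_mult_noise[OF k \<zeta>2 d])
  have \<eta>\<eta>: "has_cond_exp k (\<lambda>\<omega>. \<eta> \<omega> * \<eta> \<omega>) (\<lambda>\<omega>. d \<omega> \<bullet> (C k *v d \<omega>))"
    unfolding \<eta>_def by (rule has_cond_exp_noise_noise[OF k d d])
  have Q: "has_cond_exp k Q (\<lambda>\<omega>. 2 * p * (\<alpha> * (u \<omega> \<bullet> (C k *v d \<omega>)) - 0) + p\<^sup>2 * (d \<omega> \<bullet> (C k *v d \<omega>)))"
    unfolding Q_def by (intro has_cond_exp_add has_cond_exp_cmult has_cond_exp_diff \<eta>Z \<zeta>\<eta> \<eta>\<eta> kN)
  have Zm: "Z \<in> borel_measurable M"
    by (rule measurable_F_imp[OF order_refl L2F_measurable[OF Z2]])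
  have Z\<zeta>2: "(\<lambda>\<omega>. Z \<omega> - \<zeta> \<omega>) \<in> L2F M e N"
    by (rule L2F_diff[OF order_refl Z2 L2F_mono[OF kN(1) \<zeta>2]])
  have sq: "integrable M (\<lambda>\<omega>. (Z \<omega> - \<zeta> \<omega>)\<^sup>2)"
    using Z\<zeta>2 by (simp add: L2F_def)
  have dm: "(\<lambda>\<omega>. p * (Ex k \<omega> \<bullet> d \<omega>)) \<in> borel_measurable M"
    by (rule measurable_F_imp[OF kN(2) L2F_measurable[OF L2F_cmult[OF kN(2) L2F_excess_inner[OF k d]]]])
  have \<zeta>m: "\<zeta> \<in> borel_measurable M"
    by (rule measurable_F_imp[OF kN(1) L2F_measurable[OF \<zeta>2]])
  have Em: "E f \<in> borel_measurable M" for f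
    unfolding E_def by simp
  have "AE \<omega> in M. (Z' \<omega> - E Z' \<omega>)\<^sup>2 = (Z \<omega> - \<zeta> \<omega>)\<^sup>2 + Q \<omega>"
    using Z'\<zeta> unfolding has_cond_exp_def E_def[symmetric]
    by (auto simp: Z'_def Q_def \<eta>_def inner_diff_left power2_eq_square algebra_simps)
  then have "AE \<omega> in M. E (\<lambda>\<omega>'. (Z' \<omega>' - E Z' \<omega>')\<^sup>2) \<omega> = E (\<lambda>\<omega>. (Z \<omega> - \<zeta> \<omega>)\<^sup>2 + Q \<omega>) \<omega>"
    unfolding E_def
    by (rule real_cond_exp_cong) (use Zm \<zeta>m dm Em sq Q in \<open>auto simp: Z'_def E_def has_cond_exp_def intro!: borel_measurable_power borel_measurable_diff borel_measurable_add\<close>)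
  moreover have "AE \<omega> in M. E (\<lambda>\<omega>. (Z \<omega> - \<zeta> \<omega>)\<^sup>2 + Q \<omega>) \<omega> = E (\<lambda>\<omega>. (Z \<omega> - \<zeta> \<omega>)\<^sup>2) \<omega> + E Q \<omega>"
    unfolding E_def using Q by (intro real_cond_exp_add sq) (simp add: has_cond_exp_def)
  moreover have "AE \<omega> in M. E (\<lambda>\<omega>'. (Z \<omega>' - E Z \<omega>')\<^sup>2) \<omega> = E (\<lambda>\<omega>. (Z \<omega> - \<zeta> \<omega>)\<^sup>2) \<omega>"
    unfolding E_def
    by (rule real_cond_exp_cong) (use Z\<zeta> Zm \<zeta>m Em sq in \<open>auto simp: E_def has_cond_exp_def intro!: borel_measurable_power borel_measurable_diff\<close>)
  moreover have "AE \<omega> in M. E Q \<omega> = 2 * p * (\<alpha> * (u \<omega> \<bullet> (C k *v d \<omega>)) - 0) + p\<^sup>2 * (d \<omega> \<bullet> (C k *v d \<omega>))"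
    "AE \<omega> in M. E Z \<omega> = \<zeta> \<omega>" "AE \<omega> in M. E Z' \<omega> = \<zeta> \<omega> + p * (mean k \<bullet> d \<omega>)"
    using Q Z\<zeta> Z'\<zeta> by (simp_all add: has_cond_exp_def E_def)
  ultimately show ?thesis
    by eventually_elim (simp add: algebra_simps)
qed

end

subsection \<open>First-order condition\<close>

lemma wealth_start: "k \<le> t \<Longrightarrow> wealth s e t x u k = x"
  by (cases k) auto

lemma wealth_Suc:
  "t \<le> k \<Longrightarrow> wealth s e t x u (Suc k) = (\<lambda>\<omega>. s k * wealth s e t x u k \<omega> + excess s e k \<omega> \<bullet> u k \<omega>)"
  by simp

declare wealth.simps(2) [simp del]

text \<open>The flow property: the equilibrium condition restarts the dynamics at each time
  \<open>k\<close> from the current wealth, and this identifies the terminal wealth there with the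
  original one.\<close>

lemma wealth_restart:
  assumes "t \<le> k" "k \<le> j"
  shows "wealth s e k (wealth s e t x u k) u j = wealth s e t x u j"
  using assms(2,1) by (induction j rule: dec_induct) (simp_all add: wealth_start wealth_Suc)

text \<open>Later controls are fixed processes that do not react to the change of wealth, so the
  increment created at time \<open>k\<close> is afterwards multiplied by riskless returns only. The
  induction starts at \<open>Suc k\<close>, where the product is empty.\<close>

lemma wealth_fun_upd:
  assumes "k < j"
  shows "wealth s e k x (u(k := w)) j =
    (\<lambda>\<omega>. wealth s e k x u j \<omega> + (\<Prod>l\<in>{Suc k..<j}. s l) * (excess s e k \<omega> \<bullet> (w \<omega> - u k \<omega>)))"
  using Suc_leI[OF assms]
proof (induction j rule: dec_induct)
  case base
  show ?case
    by (simp add: wealth_start wealth_Suc inner_diff_right)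
next
  case (step j)
  then show ?case
    by (simp add: wealth_Suc algebra_simps)
qed

text \<open>Lets the size of a test perturbation tend to zero along a sequence.\<close>

lemma zero_if_le_inverse_nat:
  fixes h :: real
  assumes "\<And>n. \<bar>h\<bar> \<le> K / real (Suc n)"
  shows "h = 0"
proof (rule LIMSEQ_unique[OF tendsto_const])
  show "(\<lambda>_. h) \<longlonglongrightarrow> 0"
    by (rule Lim_null_comparison[OF _ LIMSEQ_Suc[OF lim_const_over_n[of K]]]) (use assms in auto)
qed

context market begin

lemma transpose_cov [simp]: "transpose (C k) = C k"
  by (simp add: transpose_def cov_matrix_def mult.commute)

lemma cov_symmetric: "a \<bullet> (C k *v b) = b \<bullet> (C k *v a)"
  using inner_matrix_vector_right[of a "C k" b] by (simp add: inner_commute del: transpose_matrix_vector)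

text \<open>The quadratic form is the conditional expectation of the square of the noise in
  direction \<open>a\<close>; being constant, it is nonnegative as soon as it is so almost
  surely.\<close>

lemma cov_nonneg:
  assumes k: "k < N"
  shows "a \<bullet> (C k *v a) \<ge> 0"
proof -
  have "has_cond_exp k (\<lambda>\<omega>. (D k \<omega> \<bullet> a) * (D k \<omega> \<bullet> a)) (\<lambda>\<omega>. a \<bullet> (C k *v a))"
    by (rule has_cond_exp_noise_noise) (use k in \<open>auto intro: L2F_const\<close>)
  then have *: "integrable M (\<lambda>\<omega>. (D k \<omega> \<bullet> a) * (D k \<omega> \<bullet> a))"
    "AE \<omega> in M. real_cond_exp M (F k) (\<lambda>\<omega>. (D k \<omega> \<bullet> a) * (D k \<omega> \<bullet> a)) \<omega> = a \<bullet> (C k *v a)"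
    by (simp_all only: has_cond_exp_def)
  have "AE \<omega> in M. real_cond_exp M (F k) (\<lambda>\<omega>. (D k \<omega> \<bullet> a) * (D k \<omega> \<bullet> a)) \<omega> \<ge> 0"
    by (rule sigma_finite_subalgebra.real_cond_exp_pos[OF sigma_finite_F])
       (use k borel_measurable_integrable[OF *(1)] in auto)
  with *(2) have "AE \<omega> in M. a \<bullet> (C k *v a) \<ge> 0"
    by eventually_elim simp
  then show ?thesis
    by simp
qed

lemma L2F_wealth:
  assumes u: "u \<in> controls M N e t" and x: "x \<in> L2F M e t" and k: "t \<le> k" "k \<le> N"
  shows "wealth s e t x u k \<in> L2F M e k"
  using k
proof (induction k rule: dec_induct)
  case base
  show ?case
    using x by (simp add: wealth_start)
next
  case (step k)
  then have "wealth s e t x u k \<in> L2F M e k" "u k \<in> L2F M e k" "k < N"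
    using u by (auto simp: controls_def)
  then show ?case
    using step by (auto simp: wealth_Suc intro!: L2F_add L2F_cmult L2F_excess_inner intro: L2F_mono[of k])
qed

text \<open>For d = w - u_k the cost changes by p (p (d, Cov d) + (d, h)), where \<open>h\<close> is
  the residual of the first-order condition. If \<open>h\<close> vanishes, semidefiniteness gives
  optimality; conversely small perturbations along both signs of each coordinate axis force every
  coordinate of \<open>h\<close> to vanish.\<close>

lemma optimal_at_iff:
  assumes u: "u \<in> controls M N e t" and x: "x \<in> L2F M e t" and k: "t \<le> k" "k < N"
    and s: "(\<Prod>l\<in>{Suc k..<N}. s l) > 0"
    and affine: "has_cond_exp (Suc k) (wealth s e t x u N) (\<lambda>\<omega>. \<alpha> * wealth s e t x u (Suc k) \<omega> + \<beta>)"
  shows "(\<forall>w\<in>L2F M e k. AE \<omega> in M. mv_cost M N s e \<mu>1 \<mu>2 k (wealth s e t x u k) u \<omega>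
          \<le> mv_cost M N s e \<mu>1 \<mu>2 k (wealth s e t x u k) (u(k := w)) \<omega>) \<longleftrightarrow>
      (AE \<omega> in M. (2 * \<alpha>) *\<^sub>R (C k *v u k \<omega>) = (\<mu>1 * wealth s e t x u k \<omega> + \<mu>2) *\<^sub>R mean k)"
    (is "(\<forall>w\<in>_. AE \<omega> in M. ?J u \<omega> \<le> ?J (u(k := w)) \<omega>) \<longleftrightarrow> ?foc")
proof -
  define X where "X = wealth s e t x u k"
  define p where "p = (\<Prod>l\<in>{Suc k..<N}. s l)"
  define h where "h = (\<lambda>\<omega>. (2 * \<alpha>) *\<^sub>R (C k *v u k \<omega>) - (\<mu>1 * X \<omega> + \<mu>2) *\<^sub>R mean k)"
  have p: "p > 0"
    using s by (simp add: p_def)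
  have uk: "u k \<in> L2F M e k"
    using u k by (simp add: controls_def)
  have X2: "X \<in> L2F M e k"
    unfolding X_def using k by (intro L2F_wealth u x) auto
  have ZX: "wealth s e k X u N = wealth s e t x u N"
    unfolding X_def using k by (intro wealth_restart) auto
  have Z2: "wealth s e t x u N \<in> L2F M e N"
    using k by (intro L2F_wealth u x) auto
  have Z: "has_cond_exp (Suc k) (wealth s e t x u N) (\<lambda>\<omega>. \<alpha> * (s k * X \<omega> + Ex k \<omega> \<bullet> u k \<omega>) + \<beta>)"
    using affine k by (simp add: wealth_Suc X_def)
  have var: "AE \<omega> in M. ?J (u(k := w)) \<omega>
      = ?J u \<omega> + p * (p * ((w \<omega> - u k \<omega>) \<bullet> (C k *v (w \<omega> - u k \<omega>))) + (w \<omega> - u k \<omega>) \<bullet> h \<omega>)"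
    if w: "w \<in> L2F M e k" for w
  proof -
    have d: "(\<lambda>\<omega>. w \<omega> - u k \<omega>) \<in> L2F M e k"
      using w uk k by (intro L2F_diff) auto
    note cost_variation[OF k(2) X2 uk d Z2 Z, of p "\<lambda>\<omega>. \<mu>1 * X \<omega> + \<mu>2"]
    then show ?thesis
    proof eventually_elim
      case (elim \<omega>)
      then show ?case
        unfolding mv_cost_def Let_def X_def[symmetric] wealth_fun_upd[OF k(2)] ZX p_def[symmetric] h_def
        \<comment> \<open>Symmetry moves the covariance onto \<open>u k\<close>, so that the mixed
          term becomes linear in \<open>d\<close> and merges into \<open>h\<close>.\<close>
        using cov_symmetric[of "u k \<omega>" k "w \<omega> - u k \<omega>"]
        by (simp add: inner_diff_right inner_commute[of "mean k"] power2_eq_square algebra_simps)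
    qed
  qed
  have foc: "?foc \<longleftrightarrow> (AE \<omega> in M. h \<omega> = 0)"
    by (simp add: h_def X_def)
  show ?thesis
    unfolding foc
  proof (intro iffI ballI)
    fix w :: "'a \<Rightarrow> real^'m" assume h: "AE \<omega> in M. h \<omega> = 0" and w: "w \<in> L2F M e k"
    from var[OF w] h show "AE \<omega> in M. ?J u \<omega> \<le> ?J (u(k := w)) \<omega>"
      by eventually_elim (use p cov_nonneg[OF k(2)] in auto)
  next
    assume opt: "\<forall>w\<in>L2F M e k. AE \<omega> in M. ?J u \<omega> \<le> ?J (u(k := w)) \<omega>"
    define q where "q = (\<lambda>i. axis i 1 \<bullet> (C k *v axis i 1))"
    have dir: "AE \<omega> in M. 0 \<le> p * c\<^sup>2 * q i + c * (h \<omega> $ i)" for i and c :: real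
    proof -
      have w: "(\<lambda>\<omega>. u k \<omega> + c *\<^sub>R axis i 1) \<in> L2F M e k"
        using k by (intro L2F_add L2F_const uk) auto
      from var[OF w] bspec[OF opt w] show ?thesis
      proof eventually_elim
        case (elim \<omega>)
        then have "0 \<le> p * (p * (c * (c * q i)) + c * (h \<omega> $ i))"
          by (simp add: q_def matrix_vector_mult_scaleR inner_axis' mult.assoc)
        then show ?case
          using p by (simp add: zero_le_mult_iff power2_eq_square mult.assoc)
      qed
    qed
    \<comment> \<open>Each test perturbation has its own exceptional null set. Restricting the sizes
      to plus and minus 1 / (n + 1) leaves countably many, so one null set serves all of
      them.\<close>
    have "AE \<omega> in M. \<forall>i. \<forall>n. 0 \<le> p * (1 / real (Suc n))\<^sup>2 * q i + 1 / real (Suc n) * (h \<omega> $ i)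
        \<and> 0 \<le> p * (- 1 / real (Suc n))\<^sup>2 * q i + (- 1 / real (Suc n)) * (h \<omega> $ i)"
      unfolding AE_all_countable by (intro allI AE_conjI dir)
    then show "AE \<omega> in M. h \<omega> = 0"
    proof eventually_elim
      case (elim \<omega>)
      have "h \<omega> $ i = 0" for i
      proof (rule zero_if_le_inverse_nat)
        fix n
        have n: "real (Suc n) > 0" by simp
        have "0 \<le> p * q i / real (Suc n) + h \<omega> $ i" "0 \<le> p * q i / real (Suc n) - h \<omega> $ i"
          using elim[rule_format, of n i] n
          by (simp_all add: power2_eq_square divide_simps del: of_nat_Suc)
        then show "\<bar>h \<omega> $ i\<bar> \<le> p * q i / real (Suc n)"
          by simp
      qed
      then show ?case
        by (simp add: vec_eq_iff)
    qed
  qed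
qed

text \<open>Pairing the first-order condition with \<open>y\<close> and using symmetry of the
  covariance evaluates \<open>2 * \<alpha> * (mean k \<bullet> u k \<omega>)\<close>, the only
  quantity depending on the control that survives conditioning at time \<open>k\<close>.\<close>

lemma affine_step:
  assumes u: "u \<in> controls M N e t" and x: "x \<in> L2F M e t" and k: "t \<le> k" "k < N"
    and affine: "has_cond_exp (Suc k) Z (\<lambda>\<omega>. \<alpha> * wealth s e t x u (Suc k) \<omega> + \<beta>)"
    and foc: "AE \<omega> in M. (2 * \<alpha>) *\<^sub>R (C k *v u k \<omega>) = (\<mu>1 * wealth s e t x u k \<omega> + \<mu>2) *\<^sub>R mean k"
    and y: "C k *v y = mean k"
  shows "has_cond_exp k Z (\<lambda>\<omega>. (\<alpha> * s k + \<mu>1 / 2 * (y \<bullet> mean k)) * wealth s e t x u k \<omega>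
      + (\<beta> + \<mu>2 / 2 * (y \<bullet> mean k)))"
proof -
  define X where "X = wealth s e t x u k"
  have uk: "u k \<in> L2F M e k"
    using u k by (simp add: controls_def)
  have X2: "X \<in> L2F M e k"
    unfolding X_def using k by (intro L2F_wealth u x) auto
  have Z: "has_cond_exp k Z (\<lambda>\<omega>. \<alpha> * (s k * X \<omega> + mean k \<bullet> u k \<omega>) + \<beta>)"
    by (rule has_cond_exp_affine[OF k(2) X2 uk]) (use affine k in \<open>simp add: wealth_Suc X_def\<close>)
  have "has_cond_exp k Z (\<lambda>\<omega>. (\<alpha> * s k + \<mu>1 / 2 * (y \<bullet> mean k)) * X \<omega> + (\<beta> + \<mu>2 / 2 * (y \<bullet> mean k)))"
  proof (rule has_cond_exp_cong[OF _ Z])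
    show "AE \<omega> in M. \<alpha> * (s k * X \<omega> + mean k \<bullet> u k \<omega>) + \<beta>
        = (\<alpha> * s k + \<mu>1 / 2 * (y \<bullet> mean k)) * X \<omega> + (\<beta> + \<mu>2 / 2 * (y \<bullet> mean k))"
      using foc
    proof eventually_elim
      case (elim \<omega>)
      have "2 * \<alpha> * (mean k \<bullet> u k \<omega>) = y \<bullet> ((2 * \<alpha>) *\<^sub>R (C k *v u k \<omega>))"
        using cov_symmetric[of y k "u k \<omega>"] by (simp add: y inner_commute)
      also have "\<dots> = (\<mu>1 * X \<omega> + \<mu>2) * (y \<bullet> mean k)"
        by (simp add: elim X_def)
      finally show ?case
        by (simp add: algebra_simps)
    qed
    show "(\<lambda>\<omega>. (\<alpha> * s k + \<mu>1 / 2 * (y \<bullet> mean k)) * X \<omega> + (\<beta> + \<mu>2 / 2 * (y \<bullet> mean k)))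
        \<in> borel_measurable (F k)"
      using L2F_measurable[OF X2] by simp
  qed (use k Z in \<open>auto simp: has_cond_exp_def\<close>)
  then show ?thesis
    by (simp add: X_def)
qed

lemma has_cond_exp_terminal:
  assumes u: "u \<in> controls M N e t" and x: "x \<in> L2F M e t" and "t \<le> N"
  shows "has_cond_exp N (wealth s e t x u N) (wealth s e t x u N)"
  using L2F_wealth[OF u x assms(3) order_refl]
  by (intro has_cond_exp_self L2F_integrable L2F_measurable) auto

end

subsection \<open>Equilibria\<close>

lemma mat_range_scaleR: "c \<noteq> 0 \<Longrightarrow> y \<in> mat_range A \<Longrightarrow> d *\<^sub>R y \<in> mat_range (c *\<^sub>R A)"
  unfolding mat_range_def
  by (auto simp: scaleR_matrix_vector_assoc[symmetric] matrix_vector_mult_scaleR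
      intro!: image_eqI[of _ _ "(d / c) *\<^sub>R _"])

text \<open>Inserting the feedback formula for \<open>hatv\<close> into the wealth dynamics
  reproduces the closed-loop recursion of \<open>hatX\<close>.\<close>

lemma hatX_eq_wealth: "hatX M N s e \<mu>1 \<mu>2 t x k = wealth s e t x (hatv M N s e \<mu>1 \<mu>2 t x) k"
proof (induction k)
  case (Suc k)
  show ?case
  proof (cases "Suc k \<le> t")
    case True
    then show ?thesis
      by (simp add: wealth_start)
  next
    case False
    then show ?thesis
      by (simp add: wealth_Suc Suc.IH[symmetric] hatv_def[of M N s e \<mu>1 \<mu>2 t x k] inner_diff_right algebra_simps)
  qed
qed simp

locale growing_market = market M N s e for M :: "'a measure" and N s and e :: "nat \<Rightarrow> 'a \<Rightarrow> real^'m" +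
  fixes \<mu>1 \<mu>2 :: real
  assumes riskless: "\<And>k. k < N \<Longrightarrow> s k > 1" and \<mu>1: "\<mu>1 > 0" and \<mu>2: "\<mu>2 > 0"
begin

section \<open>Equilibria force the range condition\<close>

abbreviation growth :: "nat \<Rightarrow> real" where
  "growth k \<equiv> \<Prod>l\<in>{k..<N}. s l"

lemma growth_pos: "growth k > 0"
  by (rule prod_pos) (use riskless in \<open>fastforce intro: less_trans[of 0 1]\<close>)

lemma growth_step: "k < N \<Longrightarrow> growth k = s k * growth (Suc k)"
  by (rule prod.atLeast_Suc_lessThan)

text \<open>Backward induction from slope 1 at time \<open>N\<close>. The range condition is
  required strictly after \<open>k\<close> only, so that the result is available while the condition
  at \<open>k\<close> itself is being proved. The slope stays positive because y . E O = (y, Cov y)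
  is nonnegative.\<close>

lemma equilibrium_affine:
  assumes eq: "open_loop_equilibrium M N s e \<mu>1 \<mu>2 t x u" and x: "x \<in> L2F M e t"
    and ran: "\<And>l. k < l \<Longrightarrow> l < N \<Longrightarrow> mean l \<in> mat_range (C l)"
    and k: "t \<le> k" "k < N"
  shows "\<exists>\<alpha> \<beta>. \<alpha> > 0 \<and> has_cond_exp (Suc k) (wealth s e t x u N) (\<lambda>\<omega>. \<alpha> * wealth s e t x u (Suc k) \<omega> + \<beta>)"
proof -
  have u: "u \<in> controls M N e t"
    using eq by (simp add: open_loop_equilibrium_def)
  have "Suc k \<le> N"
    using k by simp
  then show ?thesis
  proof (induction rule: inc_induct)
    case base
    show ?case
      using has_cond_exp_terminal[OF u x] k by (intro exI[of _ 1] exI[of _ 0]) simp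
  next
    case (step l)
    then obtain \<alpha> \<beta> where \<alpha>: "\<alpha> > 0"
      and affine: "has_cond_exp (Suc l) (wealth s e t x u N) (\<lambda>\<omega>. \<alpha> * wealth s e t x u (Suc l) \<omega> + \<beta>)"
      by blast
    have l: "t \<le> l" "l < N" "k < l"
      using step k by auto
    have "\<forall>w\<in>L2F M e l. AE \<omega> in M. mv_cost M N s e \<mu>1 \<mu>2 l (wealth s e t x u l) u \<omega>
          \<le> mv_cost M N s e \<mu>1 \<mu>2 l (wealth s e t x u l) (u(l := w)) \<omega>"
      using eq l by (simp add: open_loop_equilibrium_def)
    then have foc: "AE \<omega> in M. (2 * \<alpha>) *\<^sub>R (C l *v u l \<omega>) = (\<mu>1 * wealth s e t x u l \<omega> + \<mu>2) *\<^sub>R mean l"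
      using optimal_at_iff[OF u x l(1,2) growth_pos affine] by blast
    obtain y where y: "C l *v y = mean l"
      using ran[OF l(3,2)] by (auto simp: mat_range_def)
    have "y \<bullet> mean l \<ge> 0"
      using cov_nonneg[OF l(2), of y] by (simp add: y)
    then have "\<alpha> * s l + \<mu>1 / 2 * (y \<bullet> mean l) > 0"
      using \<alpha> \<mu>1 riskless[OF l(2)] by (intro add_pos_nonneg mult_pos_pos mult_nonneg_nonneg) auto
    with affine_step[OF u x l(1,2) affine foc y] show ?case
      by blast
  qed
qed

text \<open>Strong induction downwards from the last period. Starting at time \<open>k\<close> with
  wealth 0 reduces the right-hand side of the first-order condition to \<mu>2 E O_k, whose
  coefficient is nonzero.\<close>

lemma range_if_equilibria:
  assumes eq: "\<And>t. t < N \<Longrightarrow> \<exists>u. open_loop_equilibrium M N s e \<mu>1 \<mu>2 t (\<lambda>_. 0) u" and k: "k < N"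
  shows "mean k \<in> mat_range (C k)"
  using k
proof (induction "N - k" arbitrary: k rule: less_induct)
  case less
  have x: "(\<lambda>_. 0) \<in> L2F M e k"
    using less.prems by (intro L2F_const) auto
  obtain u where u: "open_loop_equilibrium M N s e \<mu>1 \<mu>2 k (\<lambda>_. 0) u"
    using eq less.prems by blast
  obtain \<alpha> \<beta> where \<alpha>: "\<alpha> > 0"
    and affine: "has_cond_exp (Suc k) (wealth s e k (\<lambda>_. 0) u N) (\<lambda>\<omega>. \<alpha> * wealth s e k (\<lambda>_. 0) u (Suc k) \<omega> + \<beta>)"
    using equilibrium_affine[OF u x _ order_refl less.prems] less.hyps less.prems
    by (metis diff_less_mono2)
  have "u \<in> controls M N e k" and "\<forall>w\<in>L2F M e k. AE \<omega> in M.
      mv_cost M N s e \<mu>1 \<mu>2 k (wealth s e k (\<lambda>_. 0) u k) u \<omega>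
        \<le> mv_cost M N s e \<mu>1 \<mu>2 k (wealth s e k (\<lambda>_. 0) u k) (u(k := w)) \<omega>"
    using u less.prems by (simp_all add: open_loop_equilibrium_def)
  then have "AE \<omega> in M. (2 * \<alpha>) *\<^sub>R (C k *v u k \<omega>) = (\<mu>1 * wealth s e k (\<lambda>_. 0) u k \<omega> + \<mu>2) *\<^sub>R mean k"
    using optimal_at_iff[OF _ x order_refl less.prems growth_pos affine] by blast
  \<comment> \<open>An almost sure identity on a probability space holds at some point; the control
    at that point, rescaled, is the preimage of the mean.\<close>
  from eventually_happens'[OF ae_filter_bot this]
  obtain \<omega> where "(2 * \<alpha>) *\<^sub>R (C k *v u k \<omega>) = \<mu>2 *\<^sub>R mean k"
    by (auto simp: wealth_start)
  then have "mean k = C k *v ((2 * \<alpha> / \<mu>2) *\<^sub>R u k \<omega>)"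
    using \<mu>2 by (simp add: matrix_vector_mult_scaleR vector_fraction_eq_iff eq_vector_fraction_iff)
  then show ?case
    by (auto simp: mat_range_def)
qed

section \<open>The proposed control is an equilibrium under the range condition\<close>

abbreviation v :: "nat \<Rightarrow> ('a \<Rightarrow> real) \<Rightarrow> nat \<Rightarrow> 'a \<Rightarrow> real^'m" where
  "v t x \<equiv> hatv M N s e \<mu>1 \<mu>2 t x"

text \<open>Square-integrability passes alternately from \<open>hatX\<close> at time
  \<open>k\<close> to the control at \<open>k\<close>, and from both to \<open>hatX\<close> at
  \<open>Suc k\<close>.\<close>

lemma hatv_controls:
  assumes x: "x \<in> L2F M e t"
  shows "v t x \<in> controls M N e t"
proof -
  have v: "v t x k \<in> L2F M e k" if "hatX M N s e \<mu>1 \<mu>2 t x k \<in> L2F M e k" "k \<le> N" for k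
  proof -
    have "(\<lambda>\<omega>. hatX M N s e \<mu>1 \<mu>2 t x k \<omega> *\<^sub>R (- (mp_inverse (hatO M N s e \<mu>1 k) *v hatL M N s e \<mu>1 k))
        - mp_inverse (hatO M N s e \<mu>1 k) *v hat\<theta> M N s e \<mu>2 k) \<in> L2F M e k"
      by (intro L2F_diff L2F_const L2F_bounded_linear[OF _ that(1) bounded_linear_scaleR_left] that(2))
    then show ?thesis
      by (simp add: hatv_def[abs_def])
  qed
  have X: "hatX M N s e \<mu>1 \<mu>2 t x k \<in> L2F M e k" if "t \<le> k" "k \<le> N" for k
    using that
  proof (induction k rule: dec_induct)
    case base
    show ?case
      using x by (simp add: hatX_eq_wealth wealth_start)
  next
    case (step k)
    then have "hatX M N s e \<mu>1 \<mu>2 t x k \<in> L2F M e k" "k < N"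
      by auto
    moreover from this v have "v t x k \<in> L2F M e k"
      by simp
    moreover have "hatX M N s e \<mu>1 \<mu>2 t x (Suc k) =
        (\<lambda>\<omega>. s k * hatX M N s e \<mu>1 \<mu>2 t x k \<omega> + Ex k \<omega> \<bullet> v t x k \<omega>)"
      using step by (simp add: hatX_eq_wealth wealth_Suc)
    ultimately show ?case
      by (auto intro!: L2F_add L2F_cmult L2F_excess_inner intro: L2F_mono[of k])
  qed
  show ?thesis
    using v X by (simp add: controls_def)
qed

text \<open>Both \<open>hatL\<close> and \<open>hat\<theta>\<close> are multiples of the mean.
  Positivity of the scalar makes \<open>hatO\<close> a nonzero multiple of the covariance, so the
  two have the same range.\<close>

lemma hatO_range:
  assumes h: "hatST M N s e \<mu>1 (Suc k) > 0" and ran: "mean k \<in> mat_range (C k)"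
  shows "hatO M N s e \<mu>1 k *v (mp_inverse (hatO M N s e \<mu>1 k) *v (c *\<^sub>R mean k)) = c *\<^sub>R mean k"
  by (rule mp_inverse_range) (use h mat_range_scaleR[OF _ ran] in \<open>simp add: hatO_def\<close>)

text \<open>This is the first-order condition with \<alpha> =
  \<open>hatST M N s e \<mu>1 (Suc k) / growth (Suc k)\<close>, the slope established in
  \<open>hatv_affine\<close>. It holds at every point, not just almost surely.\<close>

lemma hatv_first_order:
  assumes h: "hatST M N s e \<mu>1 (Suc k) > 0" and ran: "mean k \<in> mat_range (C k)"
  shows "(2 * (hatST M N s e \<mu>1 (Suc k) / growth (Suc k))) *\<^sub>R (C k *v v t x k \<omega>)
    = (\<mu>1 * wealth s e t x (v t x) k \<omega> + \<mu>2) *\<^sub>R mean k"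
proof -
  define X where "X = wealth s e t x (v t x) k \<omega>"
  define V where "V = hatO M N s e \<mu>1 k"
  define g where "g = growth (Suc k)"
  have g: "g > 0"
    unfolding g_def by (rule growth_pos)
  have v: "v t x k \<omega> = (- X) *\<^sub>R (mp_inverse V *v hatL M N s e \<mu>1 k) - mp_inverse V *v hat\<theta> M N s e \<mu>2 k"
    by (simp add: hatv_def hatX_eq_wealth V_def X_def)
  have "V *v v t x k \<omega> = (- X) *\<^sub>R (V *v (mp_inverse V *v hatL M N s e \<mu>1 k))
      - V *v (mp_inverse V *v hat\<theta> M N s e \<mu>2 k)"
    unfolding v matrix_vector_mult_diff_distrib matrix_vector_mult_scaleR ..
  also have "\<dots> = (g / 2 * (\<mu>1 * X + \<mu>2)) *\<^sub>R mean k"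
    unfolding V_def hatL_def hat\<theta>_def hatO_range[OF h ran] g_def
    by (simp add: algebra_simps flip: scaleR_add_left)
  finally have "hatST M N s e \<mu>1 (Suc k) *\<^sub>R (C k *v v t x k \<omega>) = (g / 2 * (\<mu>1 * X + \<mu>2)) *\<^sub>R mean k"
    by (simp add: V_def hatO_def scaleR_matrix_vector_assoc)
  then have "(2 / g) *\<^sub>R (hatST M N s e \<mu>1 (Suc k) *\<^sub>R (C k *v v t x k \<omega>)) = (\<mu>1 * X + \<mu>2) *\<^sub>R mean k"
    using g by simp
  then show ?thesis
    by (simp add: g_def X_def)
qed

text \<open>Division of the recursion by \<open>growth k = s k * growth (Suc k)\<close> turns it
  into the slope recursion of \<open>affine_step\<close>, which identifies the slope and shows that
  positivity is preserved.\<close>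

lemma hatST_step:
  assumes k: "k < N" and h: "hatST M N s e \<mu>1 (Suc k) > 0" and ran: "mean k \<in> mat_range (C k)"
  obtains y where "C k *v y = mean k" and "hatST M N s e \<mu>1 k > 0"
    and "hatST M N s e \<mu>1 k / growth k
      = hatST M N s e \<mu>1 (Suc k) / growth (Suc k) * s k + \<mu>1 / 2 * (y \<bullet> mean k)"
proof -
  define H where "H = hatST M N s e \<mu>1 (Suc k)"
  define g where "g = growth (Suc k)"
  define a where "a = mp_inverse (hatO M N s e \<mu>1 k) *v hatL M N s e \<mu>1 k"
  \<comment> \<open>The vector \<open>a\<close> satisfies H Cov a = -(\<mu>1 / 2) g E O_k, so this
    multiple of it is a preimage of the mean under the covariance.\<close>
  define y where "y = (- (2 / \<mu>1) * (H / g)) *\<^sub>R a"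
  have pos: "g > 0" "H > 0" "s k > 0"
    using growth_pos h riskless[OF k] by (auto simp: g_def H_def)
  have "H *\<^sub>R (C k *v a) = hatO M N s e \<mu>1 k *v a"
    by (simp add: hatO_def H_def scaleR_matrix_vector_assoc)
  also have "\<dots> = (- (\<mu>1 / 2) * g) *\<^sub>R mean k"
    unfolding a_def hatL_def hatO_range[OF h ran] g_def ..
  finally have Ca: "H *\<^sub>R (C k *v a) = (- (\<mu>1 / 2) * g) *\<^sub>R mean k" .
  have "C k *v y = (- (2 / \<mu>1) / g) *\<^sub>R (H *\<^sub>R (C k *v a))"
    unfolding y_def matrix_vector_mult_scaleR by simp
  then have y: "C k *v y = mean k"
    using \<mu>1 pos by (simp add: Ca)
  have ST: "hatST M N s e \<mu>1 k = H * (s k)\<^sup>2 - s k * H * (mean k \<bullet> a)"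
    using k by (simp add: hatST_rec H_def a_def)
  have step: "hatST M N s e \<mu>1 k / growth k = H / g * s k + \<mu>1 / 2 * (y \<bullet> mean k)"
    using pos \<mu>1 unfolding ST growth_step[OF k] g_def[symmetric] y_def
    by (simp add: inner_commute[of a] field_simps power2_eq_square)
  have "y \<bullet> mean k \<ge> 0"
    using cov_nonneg[OF k, of y] by (simp add: y)
  then have "hatST M N s e \<mu>1 k / growth k > 0"
    unfolding step using pos \<mu>1 by (intro add_pos_nonneg mult_pos_pos mult_nonneg_nonneg divide_pos_pos) auto
  then have "hatST M N s e \<mu>1 k > 0"
    using growth_pos[of k] by (simp add: zero_less_divide_iff)
  with y step show thesis
    using that by (simp add: H_def g_def)
qed

text \<open>Positivity and the affine form are carried through one induction, since the step to time
  \<open>l\<close> uses positivity at \<open>Suc l\<close> to invert \<open>hatO\<close> on the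
  mean. At time \<open>N\<close> both \<open>hatST\<close> and the empty product
  \<open>growth\<close> equal 1.\<close>

lemma hatv_affine:
  assumes x: "x \<in> L2F M e t" and ran: "\<And>l. l < N \<Longrightarrow> mean l \<in> mat_range (C l)"
    and k: "t \<le> k" "k \<le> N"
  shows "hatST M N s e \<mu>1 k > 0 \<and> (\<exists>\<beta>. has_cond_exp k (wealth s e t x (v t x) N)
    (\<lambda>\<omega>. hatST M N s e \<mu>1 k / growth k * wealth s e t x (v t x) k \<omega> + \<beta>))"
  using k(2)
proof (induction rule: inc_induct)
  case base
  show ?case
    using has_cond_exp_terminal[OF hatv_controls[OF x] x] k by (auto simp: hatST_terminal intro!: exI[of _ 0])
next
  case (step l)
  then have l: "t \<le> l" "l < N" and h: "hatST M N s e \<mu>1 (Suc l) > 0"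
    using k by auto
  obtain \<beta> where affine: "has_cond_exp (Suc l) (wealth s e t x (v t x) N)
    (\<lambda>\<omega>. hatST M N s e \<mu>1 (Suc l) / growth (Suc l) * wealth s e t x (v t x) (Suc l) \<omega> + \<beta>)"
    using step by blast
  obtain y where y: "C l *v y = mean l" and pos: "hatST M N s e \<mu>1 l > 0"
    and ST: "hatST M N s e \<mu>1 l / growth l
      = hatST M N s e \<mu>1 (Suc l) / growth (Suc l) * s l + \<mu>1 / 2 * (y \<bullet> mean l)"
    using hatST_step[OF l(2) h ran[OF l(2)]] by blast
  show ?case
    using affine_step[OF hatv_controls[OF x] x l affine AE_I2[OF hatv_first_order[OF h ran[OF l(2)]]] y] pos
    unfolding ST[symmetric] by blast
qed

lemma hatv_equilibrium:
  assumes x: "x \<in> L2F M e t" and ran: "\<And>l. l < N \<Longrightarrow> mean l \<in> mat_range (C l)"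
  shows "open_loop_equilibrium M N s e \<mu>1 \<mu>2 t x (v t x)"
  unfolding open_loop_equilibrium_def
proof (rule conjI[OF hatv_controls[OF x]], rule ballI)
  fix k assume "k \<in> {t..<N}"
  then have k: "t \<le> k" "k < N"
    by auto
  obtain \<beta> where h: "hatST M N s e \<mu>1 (Suc k) > 0" and affine: "has_cond_exp (Suc k) (wealth s e t x (v t x) N)
    (\<lambda>\<omega>. hatST M N s e \<mu>1 (Suc k) / growth (Suc k) * wealth s e t x (v t x) (Suc k) \<omega> + \<beta>)"
    using hatv_affine[OF x ran, of "Suc k"] k by auto
  show "\<forall>w\<in>L2F M e k. AE \<omega> in M. mv_cost M N s e \<mu>1 \<mu>2 k (wealth s e t x (v t x) k) (v t x) \<omega>
          \<le> mv_cost M N s e \<mu>1 \<mu>2 k (wealth s e t x (v t x) k) ((v t x)(k := w)) \<omega>"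
    unfolding optimal_at_iff[OF hatv_controls[OF x] x k growth_pos affine]
    by (rule AE_I2[OF hatv_first_order[OF h ran[OF k(2)]]])
qed

end

theorem theorem3p1:
  fixes M :: "'a measure" and N :: nat and s :: "nat \<Rightarrow> real"
    and e :: "nat \<Rightarrow> 'a \<Rightarrow> real^'m" and \<mu>1 \<mu>2 :: real
  assumes "prob_space M"
    and "N \<ge> 1"
    and "\<And>k. k < N \<Longrightarrow> s k > 1"
    and "\<mu>1 > 0" and "\<mu>2 > 0"
    and "prob_space.indep_vars M (\<lambda>_. borel) e {..<N}"
    and "\<And>k. k < N \<Longrightarrow> integrable M (\<lambda>\<omega>. (norm (e k \<omega>))\<^sup>2)"
  shows
    "((\<forall>t<N. \<forall>x\<in>L2F M e t. \<exists>u. open_loop_equilibrium M N s e \<mu>1 \<mu>2 t x u)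
        \<longleftrightarrow> (\<forall>k<N. integral\<^sup>L M (excess s e k) \<in> mat_range (cov_matrix M (excess s e k))))
     \<and> ((\<forall>t<N. \<forall>x\<in>L2F M e t. \<exists>u. open_loop_equilibrium M N s e \<mu>1 \<mu>2 t x u)
          \<or> (\<forall>k<N. integral\<^sup>L M (excess s e k) \<in> mat_range (cov_matrix M (excess s e k)))
        \<longrightarrow> (\<forall>t<N. \<forall>x\<in>L2F M e t.
              open_loop_equilibrium M N s e \<mu>1 \<mu>2 t x (hatv M N s e \<mu>1 \<mu>2 t x)))"
    (is "(?eq \<longleftrightarrow> ?ran) \<and> (_ \<longrightarrow> ?hat)")
proof -
  interpret prob_space M
    by fact
  interpret growing_market M N s e \<mu>1 \<mu>2
    by unfold_locales (use assms in auto)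
  \<comment> \<open>The three assertions are proved in a circle: equilibria from zero initial wealth
    give the range condition, which gives the explicit equilibrium, which in turn witnesses
    existence.\<close>
  have 1: ?ran if ?eq
  proof (intro allI impI range_if_equilibria)
    fix t assume "t < N"
    moreover from this have "(\<lambda>_. 0 :: real) \<in> L2F M e t"
      by (intro L2F_const) simp
    ultimately show "\<exists>u. open_loop_equilibrium M N s e \<mu>1 \<mu>2 t (\<lambda>_. 0) u"
      using that by blast
  qed
  have 2: ?hat if ?ran
    using that hatv_equilibrium by blast
  have 3: ?eq if ?hat
    using that by blast
  show ?thesis
    using 1 2 3 by argo
qed

end
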